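(* Let $k$ be a positive definite kernel on a set $S$, with $d_k(t,s)=\sqrt{k(t,t)-2\,\mathrm{Re}\,k(t,s)+k(s,s)}$ a metric on $S$ and $\mathcal B_k$ the (completed) Borel $\sigma$-algebra of $d_k$. Let $\mathfrak M_1(k)$ be the space of (equivalence classes of) signed measures $\xi$ on $\mathcal B_k$ such that $\iint_{S\times S}\overline{d\xi(t)}\,k(t,s)\,d\xi(s)<\infty$, with the form $\langle\xi,\eta\rangle_k=\iint_{S\times S}\overline{d\eta(t)}k(t,s)d\xi(s)$, two measures being identified when $\langle\xi_1-\xi_2,\xi_1-\xi_2\rangle_k=0$. Let $(\mathfrak M_1(k))^*$ be the space of continuous anti-linear functionals on $\mathfrak M_1(k)$ with the dual norm $\|f\|_{(\mathfrak M_1(k))^*}$. Then the space of functions on $\mathfrak M_1(k)$ of the form $\widetilde f(\xi)=\langle f,\xi\rangle$ (the duality pairing, i.e. $f$ evaluated at $\xi$), $f\in(\mathfrak M_1(k))^*$, endowed with the norm $\|\widetilde f\|=\|f\|_{(\mathfrak M_1(k))^*}$, is a Hilbert space; and the restrictions of its elements to the Dirac measures, i.e. the functions $s\mapsto\widetilde f(\delta_s)$ on $S$, form the reproducing kernel Hilbert space with reproducing kernel $k$.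
   Context: Positive definite: every matrix $(k(t_i,t_j))$ over finitely many points is Hermitian positive semidefinite; the double integral is nonnegative (possibly infinite) for every signed measure on $\mathcal B_k$. *)

theory Defs
  imports "HOL-Analysis.Analysis"
begin

definition dk :: "('s \<Rightarrow> 's \<Rightarrow> complex) \<Rightarrow> 's \<Rightarrow> 's \<Rightarrow> real" where
  "dk k t s = sqrt (Re (k t t) - 2 * Re (k t s) + Re (k s s))"

definition borel_k :: "('s \<Rightarrow> 's \<Rightarrow> complex) \<Rightarrow> 's set set" where
  "borel_k k = sigma_sets UNIV {U. openin (Metric_space.mtopology UNIV (dk k)) U}"

definition complex_measure_on :: "'s set set \<Rightarrow> ('s set \<Rightarrow> complex) \<Rightarrow> bool" where
  "complex_measure_on B \<xi> \<longleftrightarrow>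
     (\<forall>A. A \<notin> B \<longrightarrow> \<xi> A = 0) \<and>
     (\<forall>A :: nat \<Rightarrow> 's set. range A \<subseteq> B \<longrightarrow> disjoint_family A \<longrightarrow>
         (\<lambda>i. \<xi> (A i)) sums \<xi> (\<Union>i. A i))"

definition cm_rep :: "'s set set \<Rightarrow> ('s set \<Rightarrow> complex) \<Rightarrow> 's measure \<Rightarrow> ('s \<Rightarrow> complex) \<Rightarrow> bool" where
  "cm_rep B \<xi> \<mu> h \<longleftrightarrow> space \<mu> = UNIV \<and> sets \<mu> = B \<and> finite_measure \<mu> \<and> integrable \<mu> h \<and>
     (\<forall>A\<in>B. \<xi> A = set_lebesgue_integral \<mu> A h)"

definition kform :: "('s \<Rightarrow> 's \<Rightarrow> complex) \<Rightarrow> ('s set \<Rightarrow> complex) \<Rightarrow> ('s set \<Rightarrow> complex) \<Rightarrow> complex" where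
  "kform k \<xi> \<eta> = (THE v. \<forall>\<mu> h \<nu> g. cm_rep (borel_k k) \<xi> \<mu> h \<longrightarrow> cm_rep (borel_k k) \<eta> \<nu> g \<longrightarrow>
       v = (\<integral>p. cnj (g (fst p)) * k (fst p) (snd p) * h (snd p) \<partial>completion (\<nu> \<Otimes>\<^sub>M \<mu>)))"

definition M1 :: "('s \<Rightarrow> 's \<Rightarrow> complex) \<Rightarrow> ('s set \<Rightarrow> complex) \<Rightarrow> bool" where
  "M1 k \<xi> \<longleftrightarrow> complex_measure_on (borel_k k) \<xi> \<and>
     (\<exists>\<mu> h. cm_rep (borel_k k) \<xi> \<mu> h \<and>
        integrable (completion (\<mu> \<Otimes>\<^sub>M \<mu>)) (\<lambda>p. cnj (h (fst p)) * k (fst p) (snd p) * h (snd p)))"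

definition dirac_cm :: "('s \<Rightarrow> 's \<Rightarrow> complex) \<Rightarrow> 's \<Rightarrow> ('s set \<Rightarrow> complex)" where
  "dirac_cm k s = (\<lambda>A. if A \<in> borel_k k \<and> s \<in> A then 1 else 0)"

definition pd_kernel :: "('s \<Rightarrow> 's \<Rightarrow> complex) \<Rightarrow> bool" where
  "pd_kernel k \<longleftrightarrow>
     (\<forall>t s. k s t = cnj (k t s)) \<and>
     (\<forall>n (x :: nat \<Rightarrow> 's) (c :: nat \<Rightarrow> complex).
        0 \<le> Re (\<Sum>i<n. \<Sum>j<n. cnj (c i) * k (x i) (x j) * c j)) \<and>
     (\<forall>\<xi>. M1 k \<xi> \<and> (\<forall>A. Im (\<xi> A) = 0) \<longrightarrow>
        Im (kform k \<xi> \<xi>) = 0 \<and> 0 \<le> Re (kform k \<xi> \<xi>))"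

definition dual_M1 :: "('s \<Rightarrow> 's \<Rightarrow> complex) \<Rightarrow> (('s set \<Rightarrow> complex) \<Rightarrow> complex) \<Rightarrow> bool" where
  "dual_M1 k f \<longleftrightarrow>
     (\<forall>\<xi> \<eta> a b. M1 k \<xi> \<longrightarrow> M1 k \<eta> \<longrightarrow> M1 k (\<lambda>A. a * \<xi> A + b * \<eta> A) \<longrightarrow>
        f (\<lambda>A. a * \<xi> A + b * \<eta> A) = cnj a * f \<xi> + cnj b * f \<eta>) \<and>
     (\<exists>C. \<forall>\<xi>. M1 k \<xi> \<longrightarrow> cmod (f \<xi>) \<le> C * sqrt (Re (kform k \<xi> \<xi>)))"

definition dual_norm :: "('s \<Rightarrow> 's \<Rightarrow> complex) \<Rightarrow> (('s set \<Rightarrow> complex) \<Rightarrow> complex) \<Rightarrow> real" where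
  "dual_norm k f = Sup ((\<lambda>\<xi>. cmod (f \<xi>)) ` {\<xi>. M1 k \<xi> \<and> Re (kform k \<xi> \<xi>) \<le> 1})"

definition tilde :: "('s \<Rightarrow> 's \<Rightarrow> complex) \<Rightarrow> (('s set \<Rightarrow> complex) \<Rightarrow> complex) \<Rightarrow> (('s set \<Rightarrow> complex) \<Rightarrow> complex)" where
  "tilde k f = (\<lambda>\<xi>. if M1 k \<xi> then f \<xi> else 0)"

definition hilbert_fun_space :: "('a \<Rightarrow> complex) set \<Rightarrow> (('a \<Rightarrow> complex) \<Rightarrow> ('a \<Rightarrow> complex) \<Rightarrow> complex) \<Rightarrow> bool" where
  "hilbert_fun_space H ip \<longleftrightarrow>
     (\<lambda>_. 0) \<in> H \<and>
     (\<forall>x\<in>H. \<forall>y\<in>H. \<forall>a b. (\<lambda>w. a * x w + b * y w) \<in> H) \<and>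
     (\<forall>x\<in>H. \<forall>y\<in>H. \<forall>z\<in>H. \<forall>a b. ip (\<lambda>w. a * x w + b * y w) z = a * ip x z + b * ip y z) \<and>
     (\<forall>x\<in>H. \<forall>y\<in>H. ip y x = cnj (ip x y)) \<and>
     (\<forall>x\<in>H. 0 \<le> Re (ip x x) \<and> (ip x x = 0 \<longrightarrow> x = (\<lambda>_. 0))) \<and>
     (\<forall>X :: nat \<Rightarrow> ('a \<Rightarrow> complex). (\<forall>n. X n \<in> H) \<longrightarrow>
        (\<forall>e>0. \<exists>N. \<forall>m\<ge>N. \<forall>n\<ge>N.
            sqrt (Re (ip (\<lambda>w. X m w - X n w) (\<lambda>w. X m w - X n w))) < e) \<longrightarrow>
        (\<exists>x\<in>H. (\<lambda>n. sqrt (Re (ip (\<lambda>w. X n w - x w) (\<lambda>w. X n w - x w)))) \<longlonglongrightarrow> 0))"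

definition rkhs :: "('s \<Rightarrow> 's \<Rightarrow> complex) \<Rightarrow> ('s \<Rightarrow> complex) set \<Rightarrow> (('s \<Rightarrow> complex) \<Rightarrow> ('s \<Rightarrow> complex) \<Rightarrow> complex) \<Rightarrow> bool" where
  "rkhs k H ip \<longleftrightarrow> hilbert_fun_space H ip \<and>
     (\<forall>s. (\<lambda>t. k t s) \<in> H \<and> (\<forall>h\<in>H. ip h (\<lambda>t. k t s) = h s))"

end

theory Submission
  imports Defs
begin

text \<open>
  Let \<open>H\<close> be the space of functions \<open>g\<close> on the point set whose pairing with finite combinations of Dirac
  measures is bounded in the kernel norm. It is the dual of a pre-Hilbert space, hence a Hilbert space,
  in which the kernel sections span a dense subspace and have the reproducing property.

  A measure \<open>\<xi>\<close> of finite energy integrates every \<open>g\<close> in \<open>H\<close>, and \<open>g \<mapsto> \<integral> g d(cnj \<xi>)\<close> is a bounded functional.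
  The element representing it is the potential \<open>s \<mapsto> \<integral> k(s,t) d\<xi>(t)\<close>, and by Fubini its squared norm is
  the energy of \<open>\<xi>\<close>. The potential can be approximated in \<open>H\<close> by potentials of finite combinations of Dirac
  measures; therefore these combinations are dense in the measures of finite energy, and a continuous
  anti-linear functional on such measures is determined by its values on Dirac measures, which may be
  any element of \<open>H\<close>. This identification is isometric.

  The measures of finite energy need not form a linear space, because finite energy means absolute
  integrability of the kernel. It is enough that adding a multiple of a Dirac measure preserves finite energy.
\<close>

section \<open>Integration with respect to complex measures\<close>

text \<open>The obstacle is measurability. If S is nonseparable, the kernel need not be measurable
  for the product \<sigma>-algebra, so the energy is an integral over a completed product, and that
  completion depends on the measure chosen to represent \<open>\<xi>\<close>. Every representation
  is therefore compared with the polar one, total variation times phase, which is unique; integrals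
  over completed products are traced back to measurable functions that agree almost everywhere with
  the integrand, and Fubini is applied to these. The Hilbert space is built concretely from
  functions on points. No quotient by null combinations and no abstract completion is formed: the
  inner product is a limit of pairings with finite combinations, and energies equal to 0 are treated
  as a separate case where a division would occur.\<close>

lemma borel_measurable_cnj [measurable (raw)]:
  "f \<in> borel_measurable M \<Longrightarrow> (\<lambda>x. cnj (f x)) \<in> borel_measurable M"
  by (rule measurable_compose[OF _ borel_measurable_continuous_onI]) (auto intro: continuous_intros)

lemma norm_scaleR_sgn: "norm x *\<^sub>R sgn x = x" for x :: "'a::real_normed_vector"
  by (cases "x = 0") (simp_all add: sgn_div_norm)

text \<open>A function measurable for the completion agrees almost everywhere with one measurable
  for \<open>M\<close>, found separately for the real and imaginary parts. This brings integrals
  over a completed product back to a setting where Fubini and the density rules apply.\<close>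

lemma has_bochner_integral_completion_iff:
  fixes F :: "'a \<Rightarrow> complex"
  shows "has_bochner_integral (completion M) F v \<longleftrightarrow>
    (\<exists>F'. has_bochner_integral M F' v \<and> (AE x in M. F x = F' x))"
proof safe
  assume F: "has_bochner_integral (completion M) F v"
  then have F_meas: "F \<in> borel_measurable (completion M)"
    by (rule borel_measurable_has_bochner_integral)
  have "(\<lambda>x. Re (F x)) \<in> borel_measurable (completion M)"
    and "(\<lambda>x. Im (F x)) \<in> borel_measurable (completion M)"
    using F_meas by simp_all
  then obtain R I where RI: "R \<in> borel_measurable M" "AE x in M. Re (F x) = R x"
      "I \<in> borel_measurable M" "AE x in M. Im (F x) = I x"
    using completion_ex_borel_measurable_real by metis
  define F' where "F' x = Complex (R x) (I x)" for x
  have "F' = (\<lambda>x. of_real (R x) + \<i> * of_real (I x))"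
    by (auto simp: F'_def complex_eq_iff)
  then have F'_meas: "F' \<in> borel_measurable M" using RI by simp
  have AE: "AE x in M. F x = F' x"
    using RI(2,4) by eventually_elim (simp add: F'_def complex_eq_iff)
  then have "AE x in completion M. F x = F' x" by (rule AE_completion)
  then have "has_bochner_integral (completion M) F' v"
    using F F_meas measurable_completion[OF F'_meas] has_bochner_integral_cong_AE by blast
  then have "has_bochner_integral M F' v"
    by (simp add: has_bochner_integral_iff integrable_completion[OF F'_meas] integral_completion[OF F'_meas])
  then show "\<exists>F'. has_bochner_integral M F' v \<and> (AE x in M. F x = F' x)" using AE by blast
next
  fix F' assume F': "has_bochner_integral M F' v" and AE: "AE x in M. F x = F' x"
  have F'_meas: "F' \<in> borel_measurable M" using F' by (rule borel_measurable_has_bochner_integral)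
  have F'c: "has_bochner_integral (completion M) F' v"
    using F' by (simp add: has_bochner_integral_iff integrable_completion[OF F'_meas] integral_completion[OF F'_meas])
  have AEc: "AE x in completion M. F x = F' x" using AE by (rule AE_completion)
  \<comment> \<open>Measurability of \<open>F\<close> is derived: its preimages differ from those of
    \<open>F'\<close> by subsets of null sets, which the completion contains.\<close>
  have "F \<in> borel_measurable (completion M)"
  proof (rule measurableI)
    fix A :: "complex set" assume A: "A \<in> sets borel"
    show "F -` A \<inter> space (completion M) \<in> sets (completion M)"
    proof (rule completion.in_sets_AE)
      show "F' -` A \<inter> space (completion M) \<in> sets (completion M)"
        using measurable_completion[OF F'_meas] A by (rule measurable_sets)
      show "AE x in completion M. (x \<in> F' -` A \<inter> space (completion M)) = (x \<in> F -` A \<inter> space (completion M))"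
        using AEc by eventually_elim simp
    qed simp
  qed simp
  then show "has_bochner_integral (completion M) F v"
    using F'c AEc measurable_completion[OF F'_meas] has_bochner_integral_cong_AE by blast
qed

lemma has_bochner_integral_completion_cong_AE:
  fixes F G :: "'a \<Rightarrow> complex"
  assumes "AE x in M. F x = G x"
  shows "has_bochner_integral (completion M) F v \<longleftrightarrow> has_bochner_integral (completion M) G v"
proof -
  have "(AE x in M. F x = F' x) \<longleftrightarrow> (AE x in M. G x = F' x)" for F'
    using assms by (auto elim: eventually_elim2)
  then show ?thesis by (simp add: has_bochner_integral_completion_iff)
qed

text \<open>Unlike \<open>has_bochner_integral_density\<close>, this does not need \<open>f\<close> to be measurable where
  \<open>w\<close> vanishes.\<close>

lemma has_bochner_integral_completion_density:
  fixes f :: "'a \<Rightarrow> complex" and w :: "'a \<Rightarrow> real"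
  assumes w[measurable]: "w \<in> borel_measurable M" and w0: "\<And>x. 0 \<le> w x"
  shows "has_bochner_integral (completion (density M w)) f v \<longleftrightarrow>
    has_bochner_integral (completion M) (\<lambda>x. w x *\<^sub>R f x) v"
  unfolding has_bochner_integral_completion_iff
proof safe
  fix F' assume F': "has_bochner_integral (density M w) F' v" and AE: "AE x in density M w. f x = F' x"
  have F'_meas: "F' \<in> borel_measurable M"
    using borel_measurable_has_bochner_integral[OF F'] by simp
  have "has_bochner_integral M (\<lambda>x. w x *\<^sub>R F' x) v"
    using F' F'_meas w0 by (simp add: has_bochner_integral_iff integrable_density integral_density)
  moreover have "AE x in M. w x *\<^sub>R f x = w x *\<^sub>R F' x"
    using AE w0 unfolding AE_density[OF measurable_compose[OF w measurable_ennreal]]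
    by (auto simp: order.order_iff_strict elim!: eventually_mono)
  ultimately show "\<exists>F'. has_bochner_integral M F' v \<and> (AE x in M. w x *\<^sub>R f x = F' x)" by blast
next
  fix F' assume F': "has_bochner_integral M F' v" and AE: "AE x in M. w x *\<^sub>R f x = F' x"
  have F'_meas[measurable]: "F' \<in> borel_measurable M"
    using borel_measurable_has_bochner_integral[OF F'] by simp
  \<comment> \<open>Dividing by \<open>w\<close> is harmless where \<open>w\<close> vanishes: there
    \<open>F'\<close> is 0 almost everywhere, and the density measure does not charge that
    set.\<close>
  define G where "G x = inverse (w x) *\<^sub>R F' x" for x
  have G_meas[measurable]: "G \<in> borel_measurable M" unfolding G_def by measurable
  have "AE x in M. w x *\<^sub>R G x = F' x"
    using AE
  proof eventually_elim
    case (elim x)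
    then show ?case by (cases "w x = 0") (simp_all add: G_def)
  qed
  then have "has_bochner_integral M (\<lambda>x. w x *\<^sub>R G x) v"
    using F' has_bochner_integral_cong_AE[of "\<lambda>x. w x *\<^sub>R G x" M F' v] by simp
  then have "has_bochner_integral (density M w) G v"
    using w0 by (simp add: has_bochner_integral_iff integrable_density integral_density)
  moreover have "AE x in density M w. f x = G x"
    unfolding AE_density[OF measurable_compose[OF w measurable_ennreal]]
    using AE
  proof eventually_elim
    case (elim x)
    show ?case by (auto simp: G_def elim[symmetric])
  qed
  ultimately show "\<exists>F'. has_bochner_integral (density M w) F' v \<and> (AE x in density M w. f x = F' x)" by blast
qed

text \<open>Used for two purposes: to strip absolute values off densities when passing to polar
  form, and to place a given measure and a point mass over one dominating measure.\<close>

lemma has_bochner_integral_completion_pair_density: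
  fixes g :: "'a \<Rightarrow> complex" and h :: "'b \<Rightarrow> complex" and p :: "'b \<Rightarrow> real" and q :: "'a \<Rightarrow> real"
  assumes [measurable]: "q \<in> borel_measurable \<sigma>" "p \<in> borel_measurable \<tau>"
    and "\<And>x. 0 \<le> q x" "\<And>x. 0 \<le> p x"
    and "finite_measure \<tau>" "finite_measure (density \<tau> p)"
  shows "has_bochner_integral (completion (density \<sigma> q \<Otimes>\<^sub>M density \<tau> p))
      (\<lambda>z. cnj (g (fst z)) * k (fst z) (snd z) * h (snd z)) v \<longleftrightarrow>
    has_bochner_integral (completion (\<sigma> \<Otimes>\<^sub>M \<tau>))
      (\<lambda>z. cnj (q (fst z) *\<^sub>R g (fst z)) * k (fst z) (snd z) * (p (snd z) *\<^sub>R h (snd z))) v"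
proof -
  have "density \<sigma> q \<Otimes>\<^sub>M density \<tau> p = density (\<sigma> \<Otimes>\<^sub>M \<tau>) (\<lambda>z. q (fst z) * p (snd z))"
    using assms by (subst pair_measure_density) (auto simp: finite_measure_def split_beta' ennreal_mult)
  moreover have "(q (fst z) * p (snd z)) *\<^sub>R (cnj (g (fst z)) * k (fst z) (snd z) * h (snd z)) =
      cnj (q (fst z) *\<^sub>R g (fst z)) * k (fst z) (snd z) * (p (snd z) *\<^sub>R h (snd z))" for z
    by (simp add: scaleR_conv_of_real)
  moreover have "(\<lambda>z. q (fst z) * p (snd z)) \<in> borel_measurable (\<sigma> \<Otimes>\<^sub>M \<tau>)" by measurable
  ultimately show ?thesis
    using assms(3,4)
    by (simp only: has_bochner_integral_completion_density[of "\<lambda>z. q (fst z) * p (snd z)"] mult_nonneg_nonneg)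
qed

text \<open>The right-hand side depends only on the values of the complex measure with density
  \<open>h\<close>, not on \<open>M\<close> and \<open>h\<close> themselves. Separating
  \<open>N\<close> from \<open>M\<close> lets one simple function be integrated against several
  representing measures.\<close>

lemma integral_simple_function_mult:
  fixes s h :: "'a \<Rightarrow> complex"
  assumes s: "simple_function N s" and sets: "sets M = sets N" and h: "integrable M h"
  shows "(\<integral>x. s x * h x \<partial>M) = (\<Sum>y\<in>s ` space N. y * set_lebesgue_integral M (s -` {y} \<inter> space N) h)"
proof -
  have sp: "space M = space N" using sets by (rule sets_eq_imp_space_eq)
  have A: "s -` {y} \<inter> space N \<in> sets M" for y
    using simple_functionD(2)[OF s] sets by simp
  have int: "integrable M (\<lambda>x. y * (indicator (s -` {y} \<inter> space N) x *\<^sub>R h x))" for y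
    by (intro integrable_mult_right integrable_mult_indicator A h)
  have "s x * h x = (\<Sum>y\<in>s ` space N. y * (indicator (s -` {y} \<inter> space N) x *\<^sub>R h x))"
    if "x \<in> space M" for x
  proof -
    have "(\<Sum>y\<in>s ` space N. y * (indicator (s -` {y} \<inter> space N) x *\<^sub>R h x)) =
        (\<Sum>y\<in>s ` space N. if y = s x then s x * h x else 0)"
      using that sp by (intro sum.cong) (auto simp: indicator_def)
    also have "\<dots> = s x * h x" using that sp simple_functionD(1)[OF s] by simp
    finally show ?thesis by simp
  qed
  then have "(\<integral>x. s x * h x \<partial>M) = (\<integral>x. (\<Sum>y\<in>s ` space N. y * (indicator (s -` {y} \<inter> space N) x *\<^sub>R h x)) \<partial>M)"
    by (intro Bochner_Integration.integral_cong) auto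
  also have "\<dots> = (\<Sum>y\<in>s ` space N. y * set_lebesgue_integral M (s -` {y} \<inter> space N) h)"
    unfolding set_lebesgue_integral_def using int
    by (simp only: Bochner_Integration.integral_sum integral_mult_right_zero)
  finally show ?thesis .
qed

section \<open>Integration through a representation of a complex measure\<close>

lemma cm_repD:
  assumes "cm_rep B \<xi> \<mu> h"
  shows "space \<mu> = UNIV" "sets \<mu> = B" "finite_measure \<mu>" "integrable \<mu> h"
    "A \<in> B \<Longrightarrow> \<xi> A = set_lebesgue_integral \<mu> A h"
  using assms by (auto simp: cm_rep_def)

lemma cm_rep_measurable: "cm_rep B \<xi> \<mu> h \<Longrightarrow> h \<in> borel_measurable \<mu>"
  by (auto simp: cm_rep_def)

text \<open>The three representing measures need not be related. On simple functions only values of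
  the set functions enter, where linearity is given, and dominated convergence passes to
  \<open>f\<close>.\<close>

lemma cm_rep_integral_lin:
  fixes f :: "'s \<Rightarrow> complex"
  assumes \<xi>: "cm_rep B \<xi> \<mu> h" and \<eta>: "cm_rep B \<eta> \<nu> g" and \<zeta>: "cm_rep B \<zeta> \<tau> w"
    and lin: "\<And>A. A \<in> B \<Longrightarrow> \<zeta> A = a * \<xi> A + b * \<eta> A"
    and f: "f \<in> borel_measurable \<mu>"
    and int: "integrable \<mu> (\<lambda>x. f x * h x)" "integrable \<nu> (\<lambda>x. f x * g x)" "integrable \<tau> (\<lambda>x. f x * w x)"
  shows "(\<integral>x. f x * w x \<partial>\<tau>) = a * (\<integral>x. f x * h x \<partial>\<mu>) + b * (\<integral>x. f x * g x \<partial>\<nu>)"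
proof -
  note R = cm_repD[OF \<xi>] cm_repD[OF \<eta>] cm_repD[OF \<zeta>]
  \<comment> \<open>The base point 0 yields approximations bounded by 2|f|, hence a dominating
    function for each of the three integrals.\<close>
  from borel_measurable_implies_sequence_metric[OF f, of 0]
  obtain s where s: "\<And>i. simple_function \<mu> (s i)" "\<And>x. (\<lambda>i. s i x) \<longlonglongrightarrow> f x"
      "\<And>i x. norm (s i x) \<le> 2 * norm (f x)"
    by (auto simp: R)
  have lim: "(\<lambda>i. \<integral>x. s i x * h' x \<partial>M) \<longlonglongrightarrow> (\<integral>x. f x * h' x \<partial>M)"
    if M: "cm_rep B \<xi>' M h'" and i: "integrable M (\<lambda>x. f x * h' x)" for M h' \<xi>'
  proof (rule integral_dominated_convergence)
    note [measurable] = cm_rep_measurable[OF M]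
    have [measurable]: "s i \<in> borel_measurable M" for i
      using borel_measurable_simple_function[OF s(1)[of i]] measurable_cong_sets[of \<mu> M borel borel] R cm_repD[OF M]
      by auto
    show "integrable M (\<lambda>x. 2 * norm (f x * h' x))" using i by simp
    show "(\<lambda>x. f x * h' x) \<in> borel_measurable M" using i by simp
    show "(\<lambda>x. s i x * h' x) \<in> borel_measurable M" for i by measurable
    show "AE x in M. (\<lambda>i. s i x * h' x) \<longlonglongrightarrow> f x * h' x"
      by (intro AE_I2 tendsto_intros s)
    show "AE x in M. norm (s i x * h' x) \<le> 2 * norm (f x * h' x)" for i
    proof (intro AE_I2)
      fix x
      show "norm (s i x * h' x) \<le> 2 * norm (f x * h' x)"
        using mult_right_mono[OF s(3)[of i x] norm_ge_zero[of "h' x"]] by (simp add: norm_mult)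
    qed
  qed
  have sim: "(\<integral>x. s i x * w x \<partial>\<tau>) = a * (\<integral>x. s i x * h x \<partial>\<mu>) + b * (\<integral>x. s i x * g x \<partial>\<nu>)" for i
  proof -
    have "s i -` {y} \<in> B" for y
      using simple_functionD(2)[OF s(1), of i "{y}"] R by simp
    then have "set_lebesgue_integral \<tau> (s i -` {y}) w =
        a * set_lebesgue_integral \<mu> (s i -` {y}) h + b * set_lebesgue_integral \<nu> (s i -` {y}) g" for y
      using lin[of "s i -` {y}"] R(5)[of "s i -` {y}"] R(10)[of "s i -` {y}"] R(15)[of "s i -` {y}"] by simp
    then show ?thesis
      using integral_simple_function_mult[OF s(1), of \<mu> h i] integral_simple_function_mult[OF s(1), of \<nu> g i]
        integral_simple_function_mult[OF s(1), of \<tau> w i] R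
      by (simp add: sum.distrib sum_distrib_left algebra_simps)
  qed
  show ?thesis
  proof (rule LIMSEQ_unique[OF lim[OF \<zeta> int(3)]])
    show "(\<lambda>i. \<integral>x. s i x * w x \<partial>\<tau>) \<longlonglongrightarrow> a * (\<integral>x. f x * h x \<partial>\<mu>) + b * (\<integral>x. f x * g x \<partial>\<nu>)"
      unfolding sim by (intro tendsto_intros lim[OF \<xi> int(1)] lim[OF \<eta> int(2)])
  qed
qed

lemma cm_rep_integral_unique:
  fixes f :: "'s \<Rightarrow> complex"
  assumes "cm_rep B \<xi> \<mu> h" "cm_rep B \<xi> \<nu> g" "f \<in> borel_measurable \<mu>"
    "integrable \<mu> (\<lambda>x. f x * h x)" "integrable \<nu> (\<lambda>x. f x * g x)"
  shows "(\<integral>x. f x * g x \<partial>\<nu>) = (\<integral>x. f x * h x \<partial>\<mu>)"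
  using cm_rep_integral_lin[OF assms(1,1,2), of 1 0 f] assms by simp

section \<open>Polar decomposition and independence of the representation\<close>

lemma cm_rep_polar:
  assumes \<xi>: "cm_rep B \<xi> \<mu> h"
  shows "cm_rep B \<xi> (density \<mu> (\<lambda>x. norm (h x))) (\<lambda>x. sgn (h x))"
proof -
  note R = cm_repD[OF \<xi>]
  note [measurable] = cm_rep_measurable[OF \<xi>]
  have sgn_h[measurable]: "(\<lambda>x. sgn (h x)) \<in> borel_measurable \<mu>" unfolding sgn_div_norm by measurable
  have "emeasure (density \<mu> (\<lambda>x. norm (h x))) (space (density \<mu> (\<lambda>x. norm (h x)))) < \<infinity>"
    using R(4) by (simp add: emeasure_density integrable_iff_bounded nn_integral_set_ennreal cong: nn_integral_cong)
  then have "finite_measure (density \<mu> (\<lambda>x. norm (h x)))" by (intro finite_measureI) simp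
  moreover have "integrable (density \<mu> (\<lambda>x. norm (h x))) (\<lambda>x. sgn (h x))"
    using R(4) by (simp add: integrable_density norm_scaleR_sgn)
  moreover have "set_lebesgue_integral (density \<mu> (\<lambda>x. norm (h x))) A (\<lambda>x. sgn (h x)) = set_lebesgue_integral \<mu> A h"
    if "A \<in> B" for A
  proof -
    have [measurable]: "A \<in> sets \<mu>" using that R by simp
    show ?thesis unfolding set_lebesgue_integral_def
      by (subst integral_density) (simp_all only: norm_scaleR_sgn scaleR_left_commute[of "norm _"],
          simp_all)
  qed
  ultimately show ?thesis using R by (simp add: cm_rep_def)
qed

text \<open>Where \<open>h\<close> vanishes \<open>sgn\<close> is 0 instead of unimodular, but that
  set is null for the density.\<close>

lemma AE_norm_sgn_density:
  fixes h :: "'a \<Rightarrow> complex"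
  assumes [measurable]: "h \<in> borel_measurable \<mu>"
  shows "AE x in density \<mu> (\<lambda>x. norm (h x)). norm (sgn (h x)) = 1"
  by (subst AE_density) (auto simp: norm_sgn)

text \<open>Minimality of the total variation: integrating the indicator of \<open>A\<close> times
  the conjugate phase of \<open>T\<close> against \<open>\<xi>\<close> gives exactly
  \<open>measure T A\<close>, while the same integral computed through \<open>T'\<close> is at most
  \<open>measure T' A\<close>.\<close>

lemma polar_measure_le:
  assumes T: "cm_rep B \<xi> T u" and T': "cm_rep B \<xi> T' u'"
    and u: "AE x in T. norm (u x) = 1" "\<And>x. norm (u x) \<le> 1" and u': "\<And>x. norm (u' x) \<le> 1"
    and A: "A \<in> B"
  shows "measure T A \<le> measure T' A"
proof -
  note R = cm_repD[OF T] and R' = cm_repD[OF T']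
  interpret T: finite_measure T by (rule R)
  interpret T': finite_measure T' by (rule R')
  define f where "f x = indicator A x * cnj (u x)" for x
  have [measurable]: "u \<in> borel_measurable T" "u' \<in> borel_measurable T'" "A \<in> sets T" "A \<in> sets T'"
    using cm_rep_measurable[OF T] cm_rep_measurable[OF T'] R R' A by auto
  have [measurable]: "u \<in> borel_measurable T'"
    using measurable_cong_sets[of T T' borel borel] R R' \<open>u \<in> borel_measurable T\<close> by auto
  have f_meas[measurable]: "f \<in> borel_measurable T" "f \<in> borel_measurable T'"
    unfolding f_def by measurable
  have f1: "norm (f x) \<le> indicator A x" for x
    using u(2)[of x] by (auto simp: f_def indicator_def)
  have f1': "norm (f x) \<le> 1" for x using f1[of x] by (auto simp: indicator_def of_bool_def split: if_splits)
  have i: "integrable T (\<lambda>x. f x * u x)"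
    using mult_le_one[OF f1' norm_ge_zero u(2)]
    by (intro T.integrable_const_bound[of _ 1]) (auto simp: norm_mult)
  have i': "integrable T' (\<lambda>x. f x * u' x)"
    using mult_le_one[OF f1' norm_ge_zero u']
    by (intro T'.integrable_const_bound[of _ 1]) (auto simp: norm_mult)
  have "(\<integral>x. f x * u x \<partial>T) = (\<integral>x. of_real (indicator A x) \<partial>T)"
  proof (rule integral_cong_AE)
    show "AE x in T. f x * u x = of_real (indicator A x)"
      using u(1)
    proof eventually_elim
      case (elim x)
      then have "cnj (u x) * u x = 1" using complex_norm_square[of "u x"] by (simp add: mult.commute)
      then show ?case by (simp add: f_def indicator_def)
    qed
  qed measurable
  also have "\<dots> = of_real (measure T A)" using R A by simp
  finally have "measure T A = norm (\<integral>x. f x * u' x \<partial>T')"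
    using cm_rep_integral_unique[OF T T' f_meas(1) i i'] by simp
  also have "\<dots> \<le> (\<integral>x. indicator A x \<partial>T')"
  proof (rule order_trans[OF integral_norm_bound integral_mono])
    show "integrable T' (indicator A :: _ \<Rightarrow> real)"
      using A R'(2) by (intro integrable_real_indicator) (auto simp: less_top[symmetric])
    show "norm (f x * u' x) \<le> indicator A x" for x
      using mult_mono[OF f1[of x] u'[of x]] by (simp add: norm_mult)
  qed (use i' in simp)
  also have "\<dots> = measure T' A" using R' A by simp
  finally show ?thesis .
qed

text \<open>The comparison in both directions identifies the total variations; the phases are then
  two densities of one complex measure relative to the same finite measure.\<close>

lemma cm_rep_polar_unique:
  assumes \<mu>: "cm_rep B \<xi> \<mu> h" and \<nu>: "cm_rep B \<xi> \<nu> g"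
  shows "density \<mu> (\<lambda>x. norm (h x)) = density \<nu> (\<lambda>x. norm (g x))" (is "?T = ?T'")
    and "AE x in density \<mu> (\<lambda>x. norm (h x)). sgn (h x) = sgn (g x)"
proof -
  note P = cm_rep_polar[OF \<mu>] and P' = cm_rep_polar[OF \<nu>]
  note R = cm_repD[OF P] and R' = cm_repD[OF P']
  note A = AE_norm_sgn_density[OF cm_rep_measurable[OF \<mu>]] AE_norm_sgn_density[OF cm_rep_measurable[OF \<nu>]]
  have s: "norm (sgn z) \<le> 1" for z :: complex by (simp add: norm_sgn)
  interpret T: finite_measure ?T by (rule R)
  interpret T': finite_measure ?T' by (rule R')
  show eq: "?T = ?T'"
  proof (rule measure_eqI)
    fix X assume "X \<in> sets ?T"
    then have X: "X \<in> B" using R by simp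
    have "measure ?T X = measure ?T' X"
      using polar_measure_le[OF P P' A(1) s s X] polar_measure_le[OF P' P A(2) s s X] by simp
    then show "emeasure ?T X = emeasure ?T' X"
      by (simp add: T.emeasure_eq_measure T'.emeasure_eq_measure)
  qed (use R(2) R'(2) in simp)
  show "AE x in ?T. sgn (h x) = sgn (g x)"
  proof (rule T.density_unique_banach)
    show "integrable ?T (\<lambda>x. sgn (g x))" using R'(4) eq by simp
    show "set_lebesgue_integral ?T X (\<lambda>x. sgn (h x)) = set_lebesgue_integral ?T X (\<lambda>x. sgn (g x))"
      if "X \<in> sets ?T" for X
      using R(5)[of X] R'(5)[of X] that R(2) by (simp add: eq)
  qed (rule R(4))
qed

lemma kernel_integral_polar:
  assumes \<mu>: "cm_rep B \<xi> \<mu> h" and \<nu>: "cm_rep B \<eta> \<nu> g"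
  shows "has_bochner_integral (completion (\<nu> \<Otimes>\<^sub>M \<mu>)) (\<lambda>z. cnj (g (fst z)) * k (fst z) (snd z) * h (snd z)) v \<longleftrightarrow>
    has_bochner_integral (completion (density \<nu> (\<lambda>x. norm (g x)) \<Otimes>\<^sub>M density \<mu> (\<lambda>x. norm (h x))))
      (\<lambda>z. cnj (sgn (g (fst z))) * k (fst z) (snd z) * sgn (h (snd z))) v"
proof -
  show ?thesis
    using cm_rep_measurable[OF \<mu>] cm_rep_measurable[OF \<nu>] cm_repD(3)[OF \<mu>] cm_repD(3)[OF cm_rep_polar[OF \<mu>]]
    by (subst has_bochner_integral_completion_pair_density) (simp_all add: norm_scaleR_sgn)
qed

text \<open>In polar form the product measures coincide and the integrands agree almost everywhere,
  whatever the kernel is. Value and integrability thus belong to the complex measures, which the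
  definite description in \<open>kform\<close> relies on.\<close>

lemma kernel_integral_rep_independent:
  assumes \<mu>: "cm_rep B \<xi> \<mu> h" "cm_rep B \<xi> \<mu>' h'" and \<nu>: "cm_rep B \<eta> \<nu> g" "cm_rep B \<eta> \<nu>' g'"
  shows "has_bochner_integral (completion (\<nu> \<Otimes>\<^sub>M \<mu>)) (\<lambda>z. cnj (g (fst z)) * k (fst z) (snd z) * h (snd z)) v \<longleftrightarrow>
    has_bochner_integral (completion (\<nu>' \<Otimes>\<^sub>M \<mu>')) (\<lambda>z. cnj (g' (fst z)) * k (fst z) (snd z) * h' (snd z)) v"
proof -
  let ?N = "density \<nu> (\<lambda>x. norm (g x))" and ?M = "density \<mu> (\<lambda>x. norm (h x))"
  interpret N: finite_measure ?N by (rule cm_repD(3)[OF cm_rep_polar[OF \<nu>(1)]])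
  interpret M: finite_measure ?M by (rule cm_repD(3)[OF cm_rep_polar[OF \<mu>(1)]])
  interpret NM: pair_sigma_finite ?N ?M by standard
  have m1: "{x \<in> space ?N. sgn (g x) = sgn (g' x)} \<in> sets ?N"
    using borel_measurable_integrable[OF cm_repD(4)[OF cm_rep_polar[OF \<nu>(1)]]]
      borel_measurable_integrable[OF cm_repD(4)[OF cm_rep_polar[OF \<nu>(2)]]] cm_rep_polar_unique(1)[OF \<nu>]
    by (intro measurable_equality_set) simp_all
  have m2: "{x \<in> space ?M. sgn (h x) = sgn (h' x)} \<in> sets ?M"
    using borel_measurable_integrable[OF cm_repD(4)[OF cm_rep_polar[OF \<mu>(1)]]]
      borel_measurable_integrable[OF cm_repD(4)[OF cm_rep_polar[OF \<mu>(2)]]] cm_rep_polar_unique(1)[OF \<mu>]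
    by (intro measurable_equality_set) simp_all
  \<comment> \<open>The set of agreement is a rectangle, hence measurable in the product, as
    required for passing from the factors to the product.\<close>
  have "{z \<in> space (?N \<Otimes>\<^sub>M ?M). sgn (g (fst z)) = sgn (g' (fst z)) \<and> sgn (h (snd z)) = sgn (h' (snd z))}
      = {x \<in> space ?N. sgn (g x) = sgn (g' x)} \<times> {x \<in> space ?M. sgn (h x) = sgn (h' x)}"
    by (auto simp: space_pair_measure)
  then have "AE z in ?N \<Otimes>\<^sub>M ?M. sgn (g (fst z)) = sgn (g' (fst z)) \<and> sgn (h (snd z)) = sgn (h' (snd z))"
    using cm_rep_polar_unique(2)[OF \<nu>] cm_rep_polar_unique(2)[OF \<mu>] m1 m2
    by (intro NM.AE_pair_measure) (auto elim!: eventually_mono)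
  then have "AE z in ?N \<Otimes>\<^sub>M ?M. cnj (sgn (g (fst z))) * k (fst z) (snd z) * sgn (h (snd z)) =
      cnj (sgn (g' (fst z))) * k (fst z) (snd z) * sgn (h' (snd z))"
    by eventually_elim simp
  from has_bochner_integral_completion_cong_AE[OF this] show ?thesis
    unfolding kernel_integral_polar[OF \<mu>(1) \<nu>(1)] kernel_integral_polar[OF \<mu>(2) \<nu>(2)]
    by (simp only: cm_rep_polar_unique(1)[OF \<mu>] cm_rep_polar_unique(1)[OF \<nu>])
qed

text \<open>\<open>\<tau>\<close> is the sum of the two measures. Each summand is at most
  \<open>\<tau>\<close>, so Radon-Nikodym applies, and finiteness allows densities that are real and
  nonnegative everywhere. This gives a representation to the sum of complex measures with unrelated
  densities.\<close>

lemma common_dominating_measure: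
  assumes "finite_measure \<mu>" "finite_measure \<nu>" and sets: "sets \<nu> = sets \<mu>"
  obtains \<tau> and p q :: "'a \<Rightarrow> real" where "finite_measure \<tau>" "sets \<tau> = sets \<mu>"
    "p \<in> borel_measurable \<tau>" "q \<in> borel_measurable \<tau>" "\<And>x. 0 \<le> p x" "\<And>x. 0 \<le> q x"
    "density \<tau> p = \<mu>" "density \<tau> q = \<nu>"
proof -
  interpret \<mu>: finite_measure \<mu> by fact
  interpret \<nu>: finite_measure \<nu> by fact
  define \<tau> where "\<tau> = measure_of (space \<mu>) (sets \<mu>) (\<lambda>A. emeasure \<mu> A + emeasure \<nu> A)"
  have sets_\<tau>: "sets \<tau> = sets \<mu>" by (simp add: \<tau>_def)
  have em: "emeasure \<tau> A = emeasure \<mu> A + emeasure \<nu> A" if "A \<in> sets \<mu>" for A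
    unfolding \<tau>_def
  proof (rule emeasure_measure_of_sigma[OF sets.sigma_algebra_axioms _ _ that])
    show "positive (sets \<mu>) (\<lambda>A. emeasure \<mu> A + emeasure \<nu> A)" by (simp add: positive_def)
    show "countably_additive (sets \<mu>) (\<lambda>A. emeasure \<mu> A + emeasure \<nu> A)"
      unfolding countably_additive_def
      using sets by (auto simp: suminf_add[symmetric] suminf_emeasure)
  qed
  have fin: "finite_measure \<tau>"
    by (rule finite_measureI) (use em[of "space \<mu>"] sets_eq_imp_space_eq[OF sets_\<tau>] in simp)
  interpret \<tau>: finite_measure \<tau> by (rule fin)
  have ex: "\<exists>p::'a \<Rightarrow> real. p \<in> borel_measurable \<tau> \<and> (\<forall>x. 0 \<le> p x) \<and> density \<tau> (\<lambda>x. ennreal (p x)) = N"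
    if N: "finite_measure N" "sets N = sets \<tau>" "\<And>A. A \<in> sets \<tau> \<Longrightarrow> emeasure N A \<le> emeasure \<tau> A" for N
  proof -
    have ac: "absolutely_continuous \<tau> N"
      unfolding absolutely_continuous_def
    proof
      fix A assume "A \<in> null_sets \<tau>"
      then show "A \<in> null_sets N" using N(2) N(3)[of A] by (auto simp: null_sets_def)
    qed
    obtain D where D: "D \<in> borel_measurable \<tau>" "AE x in \<tau>. RN_deriv \<tau> N x = ennreal (D x)" "\<And>x. 0 \<le> D x"
      using \<tau>.real_RN_deriv[OF N(1) ac N(2)] by metis
    have "density \<tau> D = density \<tau> (RN_deriv \<tau> N)"
      using D by (intro density_cong) (auto elim: eventually_mono)
    also have "\<dots> = N" using \<tau>.density_RN_deriv[OF ac N(2)] .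
    finally show ?thesis using D by blast
  qed
  obtain p :: "'a \<Rightarrow> real" where "p \<in> borel_measurable \<tau>" "\<And>x. 0 \<le> p x" "density \<tau> p = \<mu>"
    using ex[of \<mu>] em sets_\<tau> by (auto simp: \<mu>.finite_measure_axioms)
  moreover obtain q :: "'a \<Rightarrow> real" where "q \<in> borel_measurable \<tau>" "\<And>x. 0 \<le> q x" "density \<tau> q = \<nu>"
    using ex[of \<nu>] em sets_\<tau> sets by (auto simp: \<nu>.finite_measure_axioms)
  ultimately show thesis using that fin sets_\<tau> by blast
qed

lemma integrable_completion_AE:
  fixes F F' :: "'a \<Rightarrow> complex"
  assumes "integrable M F'" "AE x in M. F x = F' x"
  shows "integrable (completion M) F"
  using has_bochner_integral_completion_iff[of M F] assms by (metis has_bochner_integral_iff)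

lemma (in pair_sigma_finite) integrable_mult_pair:
  fixes f :: "'a \<Rightarrow> complex" and g :: "'b \<Rightarrow> complex"
  assumes f: "integrable M1 f" and g: "integrable M2 g"
  shows "integrable (M1 \<Otimes>\<^sub>M M2) (\<lambda>z. f (fst z) * g (snd z))"
proof (rule Fubini_integrable)
  note [measurable] = borel_measurable_integrable[OF f] borel_measurable_integrable[OF g]
  show "(\<lambda>z. f (fst z) * g (snd z)) \<in> borel_measurable (M1 \<Otimes>\<^sub>M M2)" by measurable
  show "integrable M1 (\<lambda>x. \<integral>y. norm (f (fst (x, y)) * g (snd (x, y))) \<partial>M2)"
    using f by (simp add: norm_mult)
  show "AE x in M1. integrable M2 (\<lambda>y. f (fst (x, y)) * g (snd (x, y)))"
    using g by simp
qed

section \<open>The reproducing kernel Hilbert space as a dual space\<close>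

definition finsupp :: "('s \<Rightarrow> complex) set" where
  "finsupp = {c. finite {x. c x \<noteq> 0}}"

text \<open>The value at the combination of Dirac measures with coefficients \<open>c\<close> of the
  antilinear functional that takes the values \<open>g\<close> on Dirac measures.\<close>

definition pairing :: "('s \<Rightarrow> complex) \<Rightarrow> ('s \<Rightarrow> complex) \<Rightarrow> complex" where
  "pairing g c = (\<Sum>x | c x \<noteq> 0. cnj (c x) * g x)"

definition single :: "'s \<Rightarrow> 's \<Rightarrow> complex" where
  "single s = (\<lambda>x. if x = s then 1 else 0)"

lemma finsupp_lin:
  assumes "c \<in> finsupp" "d \<in> finsupp"
  shows "(\<lambda>x. a * c x + b * d x) \<in> finsupp"
proof -
  have "{x. a * c x + b * d x \<noteq> 0} \<subseteq> {x. c x \<noteq> 0} \<union> {x. d x \<noteq> 0}" by auto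
  from finite_subset[OF this] show ?thesis using assms by (simp add: finsupp_def)
qed

lemma finsupp_add: "c \<in> finsupp \<Longrightarrow> d \<in> finsupp \<Longrightarrow> (\<lambda>x. c x + d x) \<in> finsupp"
  using finsupp_lin[of c d 1 1] by simp

lemma finsupp_diff: "c \<in> finsupp \<Longrightarrow> d \<in> finsupp \<Longrightarrow> (\<lambda>x. c x - d x) \<in> finsupp"
  using finsupp_lin[of c d 1 "-1"] by simp

lemma finsupp_scale: "c \<in> finsupp \<Longrightarrow> (\<lambda>x. a * c x) \<in> finsupp"
  using finsupp_lin[of c c a 0] by simp

lemma finsupp_zero: "(\<lambda>x. 0) \<in> finsupp"
  by (simp add: finsupp_def)

lemma finsupp_single: "single s \<in> finsupp"
  by (simp add: finsupp_def single_def)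

lemma pairing_superset:
  assumes "finite A" "{x. c x \<noteq> 0} \<subseteq> A"
  shows "pairing g c = (\<Sum>x\<in>A. cnj (c x) * g x)"
  unfolding pairing_def by (rule sum.mono_neutral_left) (use assms in auto)

lemma pairing_lin_left: "pairing (\<lambda>w. a * g w + b * h w) c = a * pairing g c + b * pairing h c"
  unfolding pairing_def by (simp add: sum.distrib sum_distrib_left algebra_simps)

lemma pairing_diff_left: "pairing (\<lambda>w. g w - h w) c = pairing g c - pairing h c"
  using pairing_lin_left[of 1 g "-1" h c] by simp

lemma pairing_lin_right:
  assumes "c \<in> finsupp" "d \<in> finsupp"
  shows "pairing g (\<lambda>x. a * c x + b * d x) = cnj a * pairing g c + cnj b * pairing g d"
proof -
  define A where "A = {x. c x \<noteq> 0} \<union> {x. d x \<noteq> 0}"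
  have A: "finite A" using assms by (simp add: A_def finsupp_def)
  have "pairing g (\<lambda>x. a * c x + b * d x) = (\<Sum>x\<in>A. cnj (a * c x + b * d x) * g x)"
    by (rule pairing_superset[OF A]) (auto simp: A_def)
  also have "\<dots> = cnj a * (\<Sum>x\<in>A. cnj (c x) * g x) + cnj b * (\<Sum>x\<in>A. cnj (d x) * g x)"
    by (simp add: sum.distrib sum_distrib_left algebra_simps)
  also have "\<dots> = cnj a * pairing g c + cnj b * pairing g d"
    using pairing_superset[OF A, of c g] pairing_superset[OF A, of d g] by (simp add: A_def)
  finally show ?thesis .
qed

lemma pairing_add_right: "c \<in> finsupp \<Longrightarrow> d \<in> finsupp \<Longrightarrow>
    pairing g (\<lambda>x. c x + d x) = pairing g c + pairing g d"
  using pairing_lin_right[of c d g 1 1] by simp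

lemma pairing_diff_right: "c \<in> finsupp \<Longrightarrow> d \<in> finsupp \<Longrightarrow>
    pairing g (\<lambda>x. c x - d x) = pairing g c - pairing g d"
  using pairing_lin_right[of c d g 1 "-1"] by simp

lemma pairing_scale_right: "c \<in> finsupp \<Longrightarrow> pairing g (\<lambda>x. a * c x) = cnj a * pairing g c"
  using pairing_lin_right[of c c g a 0] by simp

lemma pairing_single: "pairing g (single s) = g s"
  by (simp add: pairing_def single_def)

section \<open>Finite combinations of points and their energy\<close>

locale psd_kernel =
  fixes k :: "'s \<Rightarrow> 's \<Rightarrow> complex"
  assumes herm: "k s t = cnj (k t s)"
    and psd: "0 \<le> Re (\<Sum>i<(n::nat). \<Sum>j<n. cnj (c i) * k (x i) (x j) * c j)"
begin

definition comb :: "('s \<Rightarrow> complex) \<Rightarrow> 's \<Rightarrow> complex" where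
  "comb c t = (\<Sum>x | c x \<noteq> 0. k t x * c x)"

text \<open>The energy of a finite combination. Its root is only a seminorm, so it may vanish for
  nonzero \<open>c\<close>.\<close>

definition sqn :: "('s \<Rightarrow> complex) \<Rightarrow> real" where
  "sqn c = Re (pairing (comb c) c)"

lemma comb_pairing: "comb c t = cnj (pairing (\<lambda>x. k x t) c)"
  unfolding comb_def pairing_def cnj_sum
  by (intro sum.cong refl) (simp add: herm[symmetric] mult.commute)

lemma comb_lin: "c \<in> finsupp \<Longrightarrow> d \<in> finsupp \<Longrightarrow>
    comb (\<lambda>x. a * c x + b * d x) = (\<lambda>w. a * comb c w + b * comb d w)"
  by (auto simp: comb_pairing pairing_lin_right)

lemma comb_diff: "c \<in> finsupp \<Longrightarrow> d \<in> finsupp \<Longrightarrow> comb (\<lambda>x. c x - d x) = (\<lambda>w. comb c w - comb d w)"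
  using comb_lin[of c d 1 "-1"] by simp

lemma comb_scale: "c \<in> finsupp \<Longrightarrow> comb (\<lambda>x. a * c x) = (\<lambda>w. a * comb c w)"
  using comb_lin[of c c a 0] by simp

lemma comb_single: "comb (single s) = (\<lambda>t. k t s)"
  by (simp add: fun_eq_iff comb_def single_def)

lemma comb_sym: "pairing (comb c) d = cnj (pairing (comb d) c)"
proof -
  have "pairing (comb c) d = (\<Sum>x | d x \<noteq> 0. \<Sum>y | c y \<noteq> 0. cnj (d x) * (k x y * c y))"
    by (simp add: pairing_def comb_def sum_distrib_left)
  also have "\<dots> = (\<Sum>y | c y \<noteq> 0. \<Sum>x | d x \<noteq> 0. cnj (d x) * (k x y * c y))"
    by (rule sum.swap)
  also have "\<dots> = cnj (pairing (comb d) c)"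
    unfolding pairing_def comb_def sum_distrib_left cnj_sum
    by (intro sum.cong refl) (simp add: herm[symmetric] mult.commute mult.left_commute)
  finally show ?thesis .
qed

lemma sqn_nonneg: assumes "c \<in> finsupp" shows "0 \<le> sqn c"
proof -
  let ?A = "{x. c x \<noteq> 0}"
  have "finite ?A" using assms by (simp add: finsupp_def)
  then obtain e where e: "bij_betw e {..<card ?A} ?A"
    using ex_bij_betw_nat_finite by (metis atLeast0LessThan)
  have "pairing (comb c) c = (\<Sum>x\<in>?A. \<Sum>y\<in>?A. cnj (c x) * k x y * c y)"
    by (simp add: pairing_def comb_def sum_distrib_left mult.assoc)
  also have "\<dots> = (\<Sum>i<card ?A. \<Sum>j<card ?A. cnj (c (e i)) * k (e i) (e j) * c (e j))"
    by (simp add: sum.reindex_bij_betw[OF e, symmetric])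
  finally show ?thesis using psd[where n = "card ?A" and c = "\<lambda>i. c (e i)" and x = e] by (simp add: sqn_def)
qed

lemma pairing_comb_self: "pairing (comb c) c = of_real (sqn c)"
  using arg_cong[OF comb_sym[of c c], of Im] by (simp add: sqn_def complex_eq_iff)

lemma sqn_diff:
  assumes "c \<in> finsupp" "d \<in> finsupp"
  shows "sqn (\<lambda>x. c x - d x) = sqn c - 2 * Re (pairing (comb c) d) + sqn d"
  using assms comb_sym[of c d]
  by (simp add: sqn_def comb_diff pairing_diff_left pairing_diff_right)

lemma sqn_scale: "c \<in> finsupp \<Longrightarrow> sqn (\<lambda>x. a * c x) = (cmod a)\<^sup>2 * sqn c"
proof -
  assume c: "c \<in> finsupp"
  have "pairing (\<lambda>w. a * comb c w) c = a * pairing (comb c) c"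
    using pairing_lin_left[of a "comb c" 0 "comb c" c] by simp
  then have "pairing (comb (\<lambda>x. a * c x)) (\<lambda>x. a * c x) = (cnj a * a) * of_real (sqn c)"
    using c by (simp add: comb_scale pairing_scale_right pairing_comb_self mult.assoc)
  also have "cnj a * a = of_real ((cmod a)\<^sup>2)"
    by (metis complex_norm_square mult.commute)
  finally show ?thesis by (simp add: sqn_def flip: of_real_mult of_real_power)
qed

lemma sqn_single: "sqn (single s) = Re (k s s)"
  by (simp add: sqn_def comb_single pairing_single)

lemma kernel_diag_nonneg: "0 \<le> Re (k s s)"
  using sqn_nonneg[OF finsupp_single, of s] by (simp add: sqn_single)

lemma sqn_single_diff: "sqn (\<lambda>x. single s x - single t x) = Re (k s s) - 2 * Re (k s t) + Re (k t t)"
  using arg_cong[OF herm[of s t], of Re]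
  by (simp add: sqn_diff finsupp_single sqn_single comb_single pairing_single)

text \<open>For a functional \<open>g\<close> bounded by \<open>C\<close> on a pre-Hilbert space, \<open>C\<^sup>2\<close> is the supremum of
  \<open>2 Re g(d) - |d|\<^sup>2\<close>. In contrast to the supremum over the unit ball, this description makes the
  distance from \<open>g\<close> to \<open>comb c\<close> explicit (\<open>rk_norm_diff_comb\<close>).\<close>

definition rk_space :: "('s \<Rightarrow> complex) set" where
  "rk_space = {g. bdd_above ((\<lambda>d. 2 * Re (pairing g d) - sqn d) ` finsupp)}"

definition rk_norm :: "('s \<Rightarrow> complex) \<Rightarrow> real" where
  "rk_norm g = sqrt (SUP d\<in>finsupp. 2 * Re (pairing g d) - sqn d)"

text \<open>With r = \<open>sqrt (sqn d)\<close>, the estimate 2Cr - r^2 \<le> C^2 is just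
  nonnegativity of (C - r)^2.\<close>

lemma rk_spaceI:
  assumes "0 \<le> C" "\<And>d. d \<in> finsupp \<Longrightarrow> cmod (pairing g d) \<le> C * sqrt (sqn d)"
  shows rk_space_memI: "g \<in> rk_space" and rk_norm_le: "rk_norm g \<le> C"
proof -
  have *: "2 * Re (pairing g d) - sqn d \<le> C\<^sup>2" if "d \<in> finsupp" for d
  proof -
    have "Re (pairing g d) \<le> C * sqrt (sqn d)"
      using assms(2)[OF that] complex_Re_le_cmod order_trans by blast
    moreover have "0 \<le> (C - sqrt (sqn d))\<^sup>2" by simp
    ultimately show ?thesis using sqn_nonneg[OF that] by (simp add: power2_diff)
  qed
  then show "g \<in> rk_space" by (auto simp: rk_space_def bdd_above_def)
  have "(SUP d\<in>finsupp. 2 * Re (pairing g d) - sqn d) \<le> C\<^sup>2"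
    using finsupp_zero * by (intro cSUP_least) auto
  then show "rk_norm g \<le> C"
    unfolding rk_norm_def using assms(1) real_le_lsqrt by blast
qed

lemma rk_norm_upper:
  assumes "g \<in> rk_space" "d \<in> finsupp"
  shows "2 * Re (pairing g d) - sqn d \<le> (SUP d\<in>finsupp. 2 * Re (pairing g d) - sqn d)"
  using assms by (intro cSUP_upper) (auto simp: rk_space_def)

lemma rk_sup_nonneg:
  assumes "g \<in> rk_space"
  shows "0 \<le> (SUP d\<in>finsupp. 2 * Re (pairing g d) - sqn d)"
  using rk_norm_upper[OF assms finsupp_zero] by (simp add: sqn_def pairing_def)

lemma rk_norm_nonneg: "g \<in> rk_space \<Longrightarrow> 0 \<le> rk_norm g"
  unfolding rk_norm_def using rk_sup_nonneg by simp

lemma rk_norm_sq: "g \<in> rk_space \<Longrightarrow> (rk_norm g)\<^sup>2 = (SUP d\<in>finsupp. 2 * Re (pairing g d) - sqn d)"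
  unfolding rk_norm_def using rk_sup_nonneg by simp

text \<open>The converse estimate: evaluating the supremum on all multiples of \<open>d\<close>,
  rotated so that the pairing becomes a nonnegative real p, gives a quadratic inequality in the
  factor r, which is used at the vertex r = p / \<open>sqn d\<close> of the parabola.\<close>

lemma pairing_bound:
  assumes g: "g \<in> rk_space" and d: "d \<in> finsupp"
  shows "cmod (pairing g d) \<le> rk_norm g * sqrt (sqn d)"
proof -
  define p where "p = cmod (pairing g d)"
  define M where "M = (rk_norm g)\<^sup>2"
  \<comment> \<open>As \<open>sgn 0 = 0\<close>, only |u| \<le> 1 holds in general. This suffices,
    since it can only decrease the subtracted quadratic term.\<close>
  define u where "u = sgn (pairing g d)"
  have M0: "0 \<le> M" by (simp add: M_def)
  have q0: "0 \<le> sqn d" by (rule sqn_nonneg[OF d])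
  have p0: "0 \<le> p" by (simp add: p_def)
  have u1: "cmod u \<le> 1" by (simp add: u_def norm_sgn)
  have "cnj u * pairing g d = of_real p"
    unfolding u_def p_def sgn_eq
    by (cases "pairing g d = 0") (simp_all add: field_simps complex_norm_square[symmetric] power2_eq_square)
  then have up: "cnj (of_real r * u) * pairing g d = of_real (r * p)" for r
    by (simp add: mult.assoc)
  have key: "2 * (r * p) - r\<^sup>2 * sqn d \<le> M" for r
  proof -
    have "2 * Re (pairing g (\<lambda>x. (of_real r * u) * d x)) - sqn (\<lambda>x. (of_real r * u) * d x) \<le> M"
      using rk_norm_upper[OF g finsupp_scale[OF d]] rk_norm_sq[OF g] unfolding M_def by metis
    then have "2 * (r * p) - (cmod (of_real r * u))\<^sup>2 * sqn d \<le> M"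
      using up[of r] by (simp only: pairing_scale_right[OF d] sqn_scale[OF d] Re_complex_of_real)
    moreover have "(cmod (of_real r * u))\<^sup>2 \<le> r\<^sup>2"
      using u1 by (simp add: norm_mult power_mult_distrib mult_left_le power_le_one)
    ultimately show ?thesis using mult_right_mono[OF _ q0] by fastforce
  qed
  have "p\<^sup>2 \<le> M * sqn d"
  proof (cases "sqn d = 0")
    case True
    \<comment> \<open>Without a quadratic term the bound is linear in r; the r chosen below makes
      its left-hand side M + 1.\<close>
    have "p = 0"
    proof (rule ccontr)
      assume "p \<noteq> 0" then show False using key[of "(M + 1) / (2 * p)"] True by simp
    qed
    then show ?thesis using True by simp
  next
    case False
    then have q: "0 < sqn d" using q0 by simp
    then show ?thesis using key[of "p / sqn d"] by (simp add: field_simps power2_eq_square)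
  qed
  then have "p \<le> sqrt (M * sqn d)" by (simp add: real_le_rsqrt)
  then show ?thesis using rk_norm_nonneg[OF g] by (simp add: p_def M_def real_sqrt_mult)
qed

lemma rk_space_lin:
  assumes g: "g \<in> rk_space" and h: "h \<in> rk_space"
  shows "(\<lambda>w. a * g w + b * h w) \<in> rk_space"
    and "rk_norm (\<lambda>w. a * g w + b * h w) \<le> cmod a * rk_norm g + cmod b * rk_norm h"
proof -
  have C: "0 \<le> cmod a * rk_norm g + cmod b * rk_norm h"
    using rk_norm_nonneg[OF g] rk_norm_nonneg[OF h] by simp
  have B: "cmod (pairing (\<lambda>w. a * g w + b * h w) d) \<le> (cmod a * rk_norm g + cmod b * rk_norm h) * sqrt (sqn d)"
    if d: "d \<in> finsupp" for d
  proof -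
    have "cmod (a * pairing g d + b * pairing h d) \<le> cmod a * cmod (pairing g d) + cmod b * cmod (pairing h d)"
      by (metis norm_mult norm_triangle_ineq)
    also have "\<dots> \<le> cmod a * (rk_norm g * sqrt (sqn d)) + cmod b * (rk_norm h * sqrt (sqn d))"
      by (intro add_mono mult_left_mono pairing_bound g h d) auto
    finally show ?thesis by (simp add: pairing_lin_left algebra_simps)
  qed
  show "(\<lambda>w. a * g w + b * h w) \<in> rk_space"
    and "rk_norm (\<lambda>w. a * g w + b * h w) \<le> cmod a * rk_norm g + cmod b * rk_norm h"
    using rk_spaceI[OF C B] by auto
qed

lemma rk_space_diff: "g \<in> rk_space \<Longrightarrow> h \<in> rk_space \<Longrightarrow> (\<lambda>w. g w - h w) \<in> rk_space"
  using rk_space_lin(1)[of g h 1 "-1"] by simp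

text \<open>Nonnegativity of the energy of c - d says exactly that \<open>sqn c\<close> is an upper
  bound in the supremum.\<close>

lemma comb_in_rk_space: assumes c: "c \<in> finsupp" shows "comb c \<in> rk_space"
proof -
  have "2 * Re (pairing (comb c) d) - sqn d \<le> sqn c" if "d \<in> finsupp" for d
    using sqn_nonneg[OF finsupp_diff[OF c that]] sqn_diff[OF c that] by simp
  then show ?thesis by (auto simp: rk_space_def bdd_above_def)
qed

lemma kernel_in_rk_space: "(\<lambda>t. k t s) \<in> rk_space"
  using comb_in_rk_space[OF finsupp_single] by (simp add: comb_single)

lemma zero_in_rk_space: "(\<lambda>_. 0) \<in> rk_space"
  using rk_space_lin(1)[OF kernel_in_rk_space kernel_in_rk_space, of 0 _ 0] by simp

text \<open>Shifting the variable of the supremum by \<open>c\<close> changes the quadratic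
  expression by a constant. This is the expansion of a squared distance, available before there is
  an inner product.\<close>

lemma rk_norm_diff_comb:
  assumes g: "g \<in> rk_space" and c: "c \<in> finsupp"
  shows "(rk_norm (\<lambda>w. g w - comb c w))\<^sup>2 = (rk_norm g)\<^sup>2 - 2 * Re (pairing g c) + sqn c"
proof -
  have gc: "(\<lambda>w. g w - comb c w) \<in> rk_space"
    by (rule rk_space_diff[OF g comb_in_rk_space[OF c]])
  have le: "(rk_norm (\<lambda>w. g w - comb c w))\<^sup>2 \<le> (rk_norm g)\<^sup>2 - 2 * Re (pairing g c) + sqn c"
    unfolding rk_norm_sq[OF gc]
  proof (intro cSUP_least)
    fix d :: "'s \<Rightarrow> complex" assume d: "d \<in> finsupp"
    have s: "sqn (\<lambda>x. d x + c x) = sqn d + 2 * Re (pairing (comb c) d) + sqn c"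
      using sqn_diff[OF d finsupp_scale[OF c, of "-1"]] sqn_scale[OF c, of "-1"] comb_sym[of c d]
        pairing_scale_right[OF c, of _ "-1"] by simp
    show "2 * Re (pairing (\<lambda>w. g w - comb c w) d) - sqn d \<le> (rk_norm g)\<^sup>2 - 2 * Re (pairing g c) + sqn c"
      using rk_norm_upper[OF g finsupp_add[OF d c]] s
      by (simp add: rk_norm_sq[OF g] pairing_diff_left pairing_add_right[OF d c])
  qed (use finsupp_zero in auto)
  have "(rk_norm g)\<^sup>2 \<le> (rk_norm (\<lambda>w. g w - comb c w))\<^sup>2 + 2 * Re (pairing g c) - sqn c"
    unfolding rk_norm_sq[OF g]
  proof (intro cSUP_least)
    fix d :: "'s \<Rightarrow> complex" assume d: "d \<in> finsupp"
    have s: "sqn (\<lambda>x. d x - c x) = sqn d - 2 * Re (pairing (comb c) d) + sqn c"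
      using sqn_diff[OF d c] comb_sym[of c d] by simp
    show "2 * Re (pairing g d) - sqn d \<le> (rk_norm (\<lambda>w. g w - comb c w))\<^sup>2 + 2 * Re (pairing g c) - sqn c"
      using rk_norm_upper[OF gc finsupp_diff[OF d c]] s
      by (simp add: rk_norm_sq[OF gc] pairing_diff_left pairing_diff_right[OF d c] pairing_comb_self)
  qed (use finsupp_zero in auto)
  with le show ?thesis by linarith
qed

lemma rk_norm_comb: assumes c: "c \<in> finsupp" shows "rk_norm (comb c) = sqrt (sqn c)"
proof -
  have z: "rk_norm (\<lambda>w. 0) = 0"
    using rk_norm_le[of 0 "\<lambda>w. 0"] rk_norm_nonneg[OF zero_in_rk_space] by (simp add: pairing_def)
  have "(rk_norm (comb c))\<^sup>2 = sqn c"
    using rk_norm_diff_comb[OF comb_in_rk_space[OF c] c] z by (simp add: pairing_comb_self)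
  then show ?thesis using rk_norm_nonneg[OF comb_in_rk_space[OF c]] by (metis real_sqrt_unique)
qed

text \<open>A \<open>c\<close> that nearly attains the supremum is a good approximation: by the
  expansion of the squared distance, the defect from the supremum is that distance.\<close>

lemma comb_dense:
  assumes g: "g \<in> rk_space" and e: "0 < e"
  obtains c where "c \<in> finsupp" "rk_norm (\<lambda>w. g w - comb c w) < e"
proof -
  have "\<exists>c\<in>finsupp. (SUP d\<in>finsupp. 2 * Re (pairing g d) - sqn d) - e\<^sup>2 < 2 * Re (pairing g c) - sqn c"
    using e g finsupp_zero by (intro less_cSUP_iff[THEN iffD1]) (auto simp: rk_space_def)
  then obtain c where c: "c \<in> finsupp" "(rk_norm g)\<^sup>2 - e\<^sup>2 < 2 * Re (pairing g c) - sqn c"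
    by (auto simp: rk_norm_sq[OF g])
  then have "(rk_norm (\<lambda>w. g w - comb c w))\<^sup>2 < e\<^sup>2"
    by (simp add: rk_norm_diff_comb[OF g])
  then show thesis using that[OF c(1)] e power_less_imp_less_base by (metis less_imp_le)
qed

section \<open>The inner product as a limit over finite combinations\<close>

definition approx :: "('s \<Rightarrow> complex) \<Rightarrow> nat \<Rightarrow> 's \<Rightarrow> complex" where
  "approx h n = (SOME c. c \<in> finsupp \<and> rk_norm (\<lambda>w. h w - comb c w) < inverse (Suc n))"

text \<open>The inner product with \<open>comb c\<close> has to be \<open>pairing g c\<close>; this
  extends it by continuity in the second argument, along one fixed approximating sequence.\<close>

definition rk_inner :: "('s \<Rightarrow> complex) \<Rightarrow> ('s \<Rightarrow> complex) \<Rightarrow> complex" where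
  "rk_inner g h = lim (\<lambda>n. pairing g (approx h n))"

lemma approx:
  assumes "h \<in> rk_space"
  shows approx_finsupp: "approx h n \<in> finsupp"
    and "rk_norm (\<lambda>w. h w - comb (approx h n) w) < inverse (Suc n)"
proof -
  have "0 < inverse (real (Suc n))" by simp
  then have "\<exists>c. c \<in> finsupp \<and> rk_norm (\<lambda>w. h w - comb c w) < inverse (Suc n)"
    using comb_dense[OF assms] by blast
  from someI_ex[OF this] show "approx h n \<in> finsupp"
    "rk_norm (\<lambda>w. h w - comb (approx h n) w) < inverse (Suc n)"
    unfolding approx_def by auto
qed

lemma approx_tendsto:
  assumes h: "h \<in> rk_space"
  shows "(\<lambda>n. rk_norm (\<lambda>w. h w - comb (approx h n) w)) \<longlonglongrightarrow> 0"
proof (rule tendsto_sandwich[OF _ _ tendsto_const LIMSEQ_inverse_real_of_nat])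
  show "\<forall>\<^sub>F n in sequentially. 0 \<le> rk_norm (\<lambda>w. h w - comb (approx h n) w)"
    by (intro always_eventually allI rk_norm_nonneg rk_space_diff h comb_in_rk_space approx_finsupp)
  show "\<forall>\<^sub>F n in sequentially. rk_norm (\<lambda>w. h w - comb (approx h n) w) \<le> inverse (Suc n)"
    using approx(2)[OF h] by (intro always_eventually allI less_imp_le)
qed

lemma sqn_approx_dist:
  assumes h: "h \<in> rk_space" and c: "c \<in> finsupp" and d: "d \<in> finsupp"
  shows "sqrt (sqn (\<lambda>x. c x - d x)) \<le> rk_norm (\<lambda>w. h w - comb c w) + rk_norm (\<lambda>w. h w - comb d w)"
proof -
  have "rk_norm (comb (\<lambda>x. c x - d x)) = rk_norm (\<lambda>w. 1 * (h w - comb d w) + (-1) * (h w - comb c w))"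
    by (simp add: comb_diff[OF c d])
  also have "\<dots> \<le> rk_norm (\<lambda>w. h w - comb d w) + rk_norm (\<lambda>w. h w - comb c w)"
    using rk_space_lin(2)[OF rk_space_diff[OF h comb_in_rk_space[OF d]] rk_space_diff[OF h comb_in_rk_space[OF c]], of 1 "-1"]
    by simp
  finally show ?thesis by (simp add: rk_norm_comb[OF finsupp_diff[OF c d]])
qed

lemma rk_inner_tendsto:
  assumes g: "g \<in> rk_space" and h: "h \<in> rk_space"
  shows "(\<lambda>n. pairing g (approx h n)) \<longlonglongrightarrow> rk_inner g h"
proof -
  let ?r = "\<lambda>n. rk_norm (\<lambda>w. h w - comb (approx h n) w)"
  have bd: "cmod (pairing g (approx h m) - pairing g (approx h n)) \<le> rk_norm g * (?r m + ?r n)" for m n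
  proof -
    have "cmod (pairing g (\<lambda>x. approx h m x - approx h n x)) \<le> rk_norm g * sqrt (sqn (\<lambda>x. approx h m x - approx h n x))"
      by (intro pairing_bound g finsupp_diff approx_finsupp h)
    also have "\<dots> \<le> rk_norm g * (?r m + ?r n)"
      by (intro mult_left_mono sqn_approx_dist h approx_finsupp rk_norm_nonneg g)
    finally show ?thesis by (simp add: pairing_diff_right approx_finsupp h)
  qed
  have "Cauchy (\<lambda>n. pairing g (approx h n))"
  proof (rule CauchyI)
    fix e :: real assume e: "0 < e"
    have "(\<lambda>n. rk_norm g * (2 * ?r n)) \<longlonglongrightarrow> rk_norm g * (2 * 0)"
      by (intro tendsto_intros approx_tendsto h)
    then obtain N where N: "\<And>n. n \<ge> N \<Longrightarrow> \<bar>rk_norm g * (2 * ?r n)\<bar> < e"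
      using LIMSEQ_D[of _ 0 e] e by fastforce
    have "cmod (pairing g (approx h m) - pairing g (approx h n)) < e" if "m \<ge> N" "n \<ge> N" for m n
      using bd[of m n] N[OF that(1)] N[OF that(2)] by (simp add: algebra_simps)
    then show "\<exists>M. \<forall>m\<ge>M. \<forall>n\<ge>M. cmod (pairing g (approx h m) - pairing g (approx h n)) < e" by blast
  qed
  then show ?thesis unfolding rk_inner_def
    using Cauchy_convergent convergent_LIMSEQ_iff by blast
qed

lemma rk_inner_lin:
  assumes "g \<in> rk_space" "g' \<in> rk_space" "h \<in> rk_space"
  shows "rk_inner (\<lambda>w. a * g w + b * g' w) h = a * rk_inner g h + b * rk_inner g' h"
proof (rule LIMSEQ_unique)
  show "(\<lambda>n. pairing (\<lambda>w. a * g w + b * g' w) (approx h n)) \<longlonglongrightarrow> rk_inner (\<lambda>w. a * g w + b * g' w) h"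
    by (intro rk_inner_tendsto rk_space_lin assms)
  show "(\<lambda>n. pairing (\<lambda>w. a * g w + b * g' w) (approx h n)) \<longlonglongrightarrow> a * rk_inner g h + b * rk_inner g' h"
    unfolding pairing_lin_left by (intro tendsto_intros rk_inner_tendsto assms)
qed

text \<open>The sequence chosen for \<open>comb c\<close> need not be constantly \<open>c\<close>,
  but its distance to \<open>c\<close> in the seminorm tends to 0, and \<open>g\<close> is bounded
  for that seminorm.\<close>

lemma rk_inner_comb:
  assumes g: "g \<in> rk_space" and c: "c \<in> finsupp"
  shows "rk_inner g (comb c) = pairing g c"
proof (rule LIMSEQ_unique[OF rk_inner_tendsto[OF g comb_in_rk_space[OF c]]])
  let ?h = "comb c"
  let ?r = "\<lambda>n. rk_norm (\<lambda>w. ?h w - comb (approx ?h n) w)"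
  note h = comb_in_rk_space[OF c]
  have "rk_norm (\<lambda>w. comb c w - comb c w) = 0"
    using rk_norm_diff_comb[OF h c] by (simp add: pairing_comb_self rk_norm_comb[OF c] sqn_nonneg[OF c])
  then have bd: "cmod (pairing g (approx ?h n) - pairing g c) \<le> rk_norm g * ?r n" for n
    using order_trans[OF pairing_bound[OF g finsupp_diff[OF approx_finsupp[OF h] c]]
        mult_left_mono[OF sqn_approx_dist[OF h approx_finsupp[OF h] c] rk_norm_nonneg[OF g]]]
    by (simp add: pairing_diff_right approx_finsupp h c)
  have "(\<lambda>n. rk_norm g * ?r n) \<longlonglongrightarrow> 0"
    by (intro tendsto_mult_right_zero approx_tendsto h)
  then have "(\<lambda>n. pairing g (approx ?h n) - pairing g c) \<longlonglongrightarrow> 0"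
    by (rule Lim_null_comparison[OF always_eventually[OF allI[OF bd]]])
  then show "(\<lambda>n. pairing g (approx ?h n)) \<longlonglongrightarrow> pairing g c"
    by (simp add: LIM_zero_iff)
qed

lemma sqn_approx_tendsto:
  assumes h: "h \<in> rk_space"
  shows "(\<lambda>n. sqrt (sqn (approx h n))) \<longlonglongrightarrow> rk_norm h"
proof -
  let ?r = "\<lambda>n. rk_norm (\<lambda>w. h w - comb (approx h n) w)"
  have bd: "\<bar>sqrt (sqn (approx h n)) - rk_norm h\<bar> \<le> ?r n" for n
  proof -
    let ?c = "approx h n"
    note c = comb_in_rk_space[OF approx_finsupp[OF h, of n]]
    have "rk_norm (\<lambda>w. 1 * (h w - comb ?c w) + 1 * comb ?c w) \<le> ?r n + rk_norm (comb ?c)"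
      using rk_space_lin(2)[OF rk_space_diff[OF h c] c, of 1 1] by simp
    moreover have "rk_norm (\<lambda>w. 1 * h w + (-1) * (h w - comb ?c w)) \<le> rk_norm h + ?r n"
      using rk_space_lin(2)[OF h rk_space_diff[OF h c], of 1 "-1"] by simp
    ultimately show ?thesis by (simp add: rk_norm_comb[OF approx_finsupp[OF h]] abs_le_iff)
  qed
  then have "(\<lambda>n. sqrt (sqn (approx h n)) - rk_norm h) \<longlonglongrightarrow> 0"
    by (intro Lim_null_comparison[OF always_eventually approx_tendsto[OF h]]) auto
  then show ?thesis by (simp add: LIM_zero_iff)
qed

lemma rk_inner_bound:
  assumes g: "g \<in> rk_space" and h: "h \<in> rk_space"
  shows "cmod (rk_inner g h) \<le> rk_norm g * rk_norm h"
proof (rule LIMSEQ_le)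
  show "(\<lambda>n. cmod (pairing g (approx h n))) \<longlonglongrightarrow> cmod (rk_inner g h)"
    by (intro tendsto_intros rk_inner_tendsto g h)
  show "(\<lambda>n. rk_norm g * sqrt (sqn (approx h n))) \<longlonglongrightarrow> rk_norm g * rk_norm h"
    by (intro tendsto_intros sqn_approx_tendsto h)
  show "\<exists>N. \<forall>n\<ge>N. cmod (pairing g (approx h n)) \<le> rk_norm g * sqrt (sqn (approx h n))"
    using pairing_bound[OF g approx_finsupp[OF h]] by blast
qed

text \<open>The definition treats its arguments asymmetrically. Approximating both of them lets
  conjugate symmetry and the value on the diagonal be read off from finite combinations.\<close>

lemma rk_inner_double_limit:
  assumes g: "g \<in> rk_space" and h: "h \<in> rk_space"
  shows "(\<lambda>n. pairing (comb (approx g n)) (approx h n)) \<longlonglongrightarrow> rk_inner g h"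
proof -
  let ?r = "\<lambda>n. rk_norm (\<lambda>w. g w - comb (approx g n) w)"
  have bd: "cmod (pairing g (approx h n) - pairing (comb (approx g n)) (approx h n)) \<le> ?r n * sqrt (sqn (approx h n))" for n
    using pairing_bound[OF rk_space_diff[OF g comb_in_rk_space[OF approx_finsupp[OF g]]] approx_finsupp[OF h]]
    by (simp add: pairing_diff_left)
  have "(\<lambda>n. ?r n * sqrt (sqn (approx h n))) \<longlonglongrightarrow> 0 * rk_norm h"
    by (intro tendsto_intros approx_tendsto sqn_approx_tendsto g h)
  then have "(\<lambda>n. ?r n * sqrt (sqn (approx h n))) \<longlonglongrightarrow> 0" by simp
  then have "(\<lambda>n. pairing g (approx h n) - pairing (comb (approx g n)) (approx h n)) \<longlonglongrightarrow> 0"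
    by (rule Lim_null_comparison[OF always_eventually[OF allI[OF bd]]])
  from tendsto_diff[OF rk_inner_tendsto[OF g h] this] show ?thesis by simp
qed

lemma rk_inner_cnj:
  assumes g: "g \<in> rk_space" and h: "h \<in> rk_space"
  shows "rk_inner h g = cnj (rk_inner g h)"
proof (rule LIMSEQ_unique)
  show "(\<lambda>n. pairing (comb (approx h n)) (approx g n)) \<longlonglongrightarrow> rk_inner h g"
    by (rule rk_inner_double_limit[OF h g])
  show "(\<lambda>n. pairing (comb (approx h n)) (approx g n)) \<longlonglongrightarrow> cnj (rk_inner g h)"
    using tendsto_cnj[OF rk_inner_double_limit[OF g h]] comb_sym[symmetric] by simp
qed

lemma rk_inner_self:
  assumes g: "g \<in> rk_space"
  shows "rk_inner g g = of_real ((rk_norm g)\<^sup>2)"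
proof (rule LIMSEQ_unique[OF rk_inner_double_limit[OF g g]])
  have "(\<lambda>n. (of_real ((sqrt (sqn (approx g n)))\<^sup>2)::complex)) \<longlonglongrightarrow> of_real ((rk_norm g)\<^sup>2)"
    by (intro tendsto_intros sqn_approx_tendsto g)
  then show "(\<lambda>n. pairing (comb (approx g n)) (approx g n)) \<longlonglongrightarrow> of_real ((rk_norm g)\<^sup>2)"
    by (simp add: pairing_comb_self sqn_nonneg[OF approx_finsupp[OF g]])
qed

section \<open>Evaluation, completeness and Riesz representation\<close>

lemma rk_inner_kernel: "g \<in> rk_space \<Longrightarrow> rk_inner g (\<lambda>t. k t s) = g s"
  using rk_inner_comb[OF _ finsupp_single, of g s] by (simp add: comb_single pairing_single)

lemma rk_space_eval_bound: "g \<in> rk_space \<Longrightarrow> cmod (g s) \<le> rk_norm g * sqrt (Re (k s s))"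
  using pairing_bound[OF _ finsupp_single, of g s] by (simp add: pairing_single sqn_single)

text \<open>The metric is the seminorm of a difference of two unit masses. This estimate is the
  source of Borel measurability of the elements.\<close>

lemma rk_space_Lipschitz: "g \<in> rk_space \<Longrightarrow> cmod (g s - g t) \<le> rk_norm g * dk k s t"
  using pairing_bound[OF _ finsupp_diff[OF finsupp_single finsupp_single], of g s t]
  by (simp add: pairing_diff_right finsupp_single pairing_single sqn_single_diff dk_def)

text \<open>Evaluations are bounded, so a Cauchy sequence converges pointwise. A pairing is a finite
  sum and converges too, so for each fixed \<open>d\<close> the Cauchy estimate passes to the limit;
  the resulting bound yields membership and norm convergence together.\<close>

lemma rk_space_complete:
  assumes X: "\<And>n. X n \<in> rk_space"
    and Cau: "\<And>e. 0 < e \<Longrightarrow> \<exists>N. \<forall>m\<ge>N. \<forall>n\<ge>N. rk_norm (\<lambda>w. X m w - X n w) < e"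
  obtains x where "x \<in> rk_space" "(\<lambda>n. rk_norm (\<lambda>w. X n w - x w)) \<longlonglongrightarrow> 0"
proof -
  have "convergent (\<lambda>n. X n s)" for s
  proof (rule Cauchy_convergent, rule CauchyI)
    fix e :: real assume e: "0 < e"
    \<comment> \<open>Adding 1 keeps the divisor positive when the diagonal value is 0.\<close>
    define r where "r = sqrt (Re (k s s)) + 1"
    have r: "0 < r" "sqrt (Re (k s s)) \<le> r"
      using kernel_diag_nonneg[of s] by (auto simp: r_def add_nonneg_pos)
    obtain N where N: "\<forall>m\<ge>N. \<forall>n\<ge>N. rk_norm (\<lambda>w. X m w - X n w) < e / r"
      using Cau[of "e / r"] e r by auto
    have "cmod (X m s - X n s) < e" if "m \<ge> N" "n \<ge> N" for m n
    proof -
      have "cmod (X m s - X n s) \<le> rk_norm (\<lambda>w. X m w - X n w) * sqrt (Re (k s s))"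
        using rk_space_eval_bound[OF rk_space_diff[OF X X]] .
      also have "\<dots> \<le> rk_norm (\<lambda>w. X m w - X n w) * r"
        by (intro mult_left_mono r rk_norm_nonneg rk_space_diff X)
      also have "\<dots> < e / r * r" using N that r by (intro mult_strict_right_mono) auto
      finally show ?thesis using r by simp
    qed
    then show "\<exists>M. \<forall>m\<ge>M. \<forall>n\<ge>M. cmod (X m s - X n s) < e" by blast
  qed
  then obtain x where x: "\<And>s. (\<lambda>n. X n s) \<longlonglongrightarrow> x s" unfolding convergent_def by metis
  have lim: "(\<lambda>n. pairing (X n) d) \<longlonglongrightarrow> pairing x d" for d
    unfolding pairing_def by (intro tendsto_intros x)
  have close: "\<exists>N. \<forall>n\<ge>N. (\<lambda>w. X n w - x w) \<in> rk_space \<and> rk_norm (\<lambda>w. X n w - x w) \<le> e" if e: "0 < e" for e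
  proof -
    obtain N where N: "\<forall>m\<ge>N. \<forall>n\<ge>N. rk_norm (\<lambda>w. X m w - X n w) < e" using Cau[OF e] by auto
    have "cmod (pairing (\<lambda>w. X n w - x w) d) \<le> e * sqrt (sqn d)" if "n \<ge> N" "d \<in> finsupp" for n d
    proof (rule LIMSEQ_le_const2)
      show "(\<lambda>m. cmod (pairing (\<lambda>w. X n w - X m w) d)) \<longlonglongrightarrow> cmod (pairing (\<lambda>w. X n w - x w) d)"
        unfolding pairing_diff_left by (intro tendsto_intros lim)
      have "cmod (pairing (\<lambda>w. X n w - X m w) d) \<le> e * sqrt (sqn d)" if "m \<ge> N" for m
        using pairing_bound[OF rk_space_diff[OF X X] \<open>d \<in> finsupp\<close>, of n m] N \<open>n \<ge> N\<close> that
          mult_right_mono[of "rk_norm (\<lambda>w. X n w - X m w)" e "sqrt (sqn d)"] sqn_nonneg[OF \<open>d \<in> finsupp\<close>]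
        by fastforce
      then show "\<exists>N. \<forall>m\<ge>N. cmod (pairing (\<lambda>w. X n w - X m w) d) \<le> e * sqrt (sqn d)" by blast
    qed
    then show ?thesis using rk_spaceI[of e] e by (metis less_imp_le)
  qed
  obtain N where "(\<lambda>w. X N w - x w) \<in> rk_space" using close[of 1] by auto
  from rk_space_diff[OF X[of N] this] have "x \<in> rk_space" by simp
  moreover have "(\<lambda>n. rk_norm (\<lambda>w. X n w - x w)) \<longlonglongrightarrow> 0"
  proof (rule LIMSEQ_I)
    fix e :: real assume "0 < e"
    then obtain N where "\<forall>n\<ge>N. (\<lambda>w. X n w - x w) \<in> rk_space \<and> rk_norm (\<lambda>w. X n w - x w) \<le> e / 2"
      using close[of "e / 2"] by auto
    then have "norm (rk_norm (\<lambda>w. X n w - x w) - 0) < e" if "n \<ge> N" for n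
      using that \<open>0 < e\<close> rk_norm_nonneg[of "\<lambda>w. X n w - x w"] by fastforce
    then show "\<exists>N. \<forall>n\<ge>N. norm (rk_norm (\<lambda>w. X n w - x w) - 0) < e" by blast
  qed
  ultimately show thesis by (rule that)
qed


lemma rkhs_rk_space: "rkhs k rk_space rk_inner"
proof -
  have nrm: "sqrt (Re (rk_inner x x)) = rk_norm x" if "x \<in> rk_space" for x
    using rk_norm_nonneg[OF that] by (simp add: rk_inner_self[OF that])
  have zero: "x = (\<lambda>_. 0)" if "x \<in> rk_space" "rk_inner x x = 0" for x
    using rk_space_eval_bound[OF that(1)] that by (auto simp: rk_inner_self[OF that(1)])
  have comp: "\<exists>x\<in>rk_space. (\<lambda>n. sqrt (Re (rk_inner (\<lambda>w. X n w - x w) (\<lambda>w. X n w - x w)))) \<longlonglongrightarrow> 0"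
    if X: "\<forall>n. X n \<in> rk_space"
      and "\<forall>e>0. \<exists>N. \<forall>m\<ge>N. \<forall>n\<ge>N. sqrt (Re (rk_inner (\<lambda>w. X m w - X n w) (\<lambda>w. X m w - X n w))) < e" for X
  proof -
    have "\<exists>N. \<forall>m\<ge>N. \<forall>n\<ge>N. rk_norm (\<lambda>w. X m w - X n w) < e" if "0 < e" for e
      using \<open>\<forall>e>0. _\<close> that X by (simp add: nrm rk_space_diff)
    then obtain x where "x \<in> rk_space" "(\<lambda>n. rk_norm (\<lambda>w. X n w - x w)) \<longlonglongrightarrow> 0"
      using rk_space_complete[of X] X by blast
    then show ?thesis using X by (intro bexI[of _ x]) (simp_all add: nrm rk_space_diff)
  qed
  have "hilbert_fun_space rk_space rk_inner"
    unfolding hilbert_fun_space_def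
  proof (intro conjI)
    show "\<forall>x\<in>rk_space. 0 \<le> Re (rk_inner x x) \<and> (rk_inner x x = 0 \<longrightarrow> x = (\<lambda>_. 0))"
      using zero by (auto simp: rk_inner_self simp del: of_real_power)
    show "\<forall>x\<in>rk_space. \<forall>y\<in>rk_space. rk_inner y x = cnj (rk_inner x y)"
      by (intro ballI rk_inner_cnj)
    show "\<forall>X. (\<forall>n. X n \<in> rk_space) \<longrightarrow>
        (\<forall>e>0. \<exists>N. \<forall>m\<ge>N. \<forall>n\<ge>N. sqrt (Re (rk_inner (\<lambda>w. X m w - X n w) (\<lambda>w. X m w - X n w))) < e) \<longrightarrow>
        (\<exists>x\<in>rk_space. (\<lambda>n. sqrt (Re (rk_inner (\<lambda>w. X n w - x w) (\<lambda>w. X n w - x w)))) \<longlonglongrightarrow> 0)"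
      using comp by blast
  qed (intro ballI allI zero_in_rk_space rk_space_lin(1) rk_inner_lin; assumption)+
  then show ?thesis
    unfolding rkhs_def using kernel_in_rk_space rk_inner_kernel by blast
qed

text \<open>The representer is forced by the reproducing property: its value at s is the conjugate
  of \<open>L\<close> at the kernel section. Both functionals are bounded and agree on finite
  combinations, which are dense.\<close>

lemma rk_Riesz:
  assumes lin: "\<And>g h a b. g \<in> rk_space \<Longrightarrow> h \<in> rk_space \<Longrightarrow> L (\<lambda>w. a * g w + b * h w) = a * L g + b * L h"
    and bd: "\<And>g. g \<in> rk_space \<Longrightarrow> cmod (L g) \<le> C * rk_norm g"
  defines "v \<equiv> \<lambda>s. cnj (L (\<lambda>t. k t s))"
  shows "v \<in> rk_space" and "\<And>g. g \<in> rk_space \<Longrightarrow> L g = rk_inner g v"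
proof -
  have pv: "cnj (pairing v c) = L (comb c)" if "c \<in> finsupp" for c
  proof -
    have "finite A \<Longrightarrow> (\<lambda>t. \<Sum>x\<in>A. k t x * c x) \<in> rk_space \<and>
        L (\<lambda>t. \<Sum>x\<in>A. k t x * c x) = (\<Sum>x\<in>A. c x * L (\<lambda>t. k t x))" for A
    proof (induction A rule: finite_induct)
      case empty
      show ?case using lin[OF zero_in_rk_space zero_in_rk_space, of 0 0] zero_in_rk_space by simp
    next
      case (insert x A)
      then show ?case
        using lin[OF kernel_in_rk_space, of "\<lambda>t. \<Sum>x\<in>A. k t x * c x" "c x" x 1]
          rk_space_lin(1)[OF kernel_in_rk_space, of "\<lambda>t. \<Sum>x\<in>A. k t x * c x" "c x" x 1]
        by (simp add: mult.commute)
    qed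
    then show ?thesis using that
      by (simp add: finsupp_def comb_def[abs_def] pairing_def v_def)
  qed
  have bd': "cmod (L g) \<le> \<bar>C\<bar> * rk_norm g" if "g \<in> rk_space" for g
    using bd[OF that] mult_right_mono[OF abs_ge_self[of C] rk_norm_nonneg[OF that]] by linarith
  show v: "v \<in> rk_space"
  proof (rule rk_space_memI)
    fix d :: "'s \<Rightarrow> complex" assume d: "d \<in> finsupp"
    have "cmod (pairing v d) = cmod (L (comb d))" using pv[OF d] by (metis complex_mod_cnj)
    also have "\<dots> \<le> \<bar>C\<bar> * sqrt (sqn d)"
      using bd'[OF comb_in_rk_space[OF d]] rk_norm_comb[OF d] by simp
    finally show "cmod (pairing v d) \<le> \<bar>C\<bar> * sqrt (sqn d)" .
  qed simp
  fix g assume g: "g \<in> rk_space"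
  have "cmod (L g - rk_inner g v) \<le> e" if e: "0 < e" for e
  proof -
    define r where "r = \<bar>C\<bar> + rk_norm v + 1"
    have r: "0 < r" using rk_norm_nonneg[OF v] by (simp add: r_def add_nonneg_pos)
    obtain c where c: "c \<in> finsupp" "rk_norm (\<lambda>w. g w - comb c w) < e / r"
      using comb_dense[OF g, of "e / r"] e r by auto
    note kc = comb_in_rk_space[OF c(1)]
    note gc = rk_space_diff[OF g kc]
    have "L (comb c) = rk_inner (comb c) v"
      using pv[OF c(1)] rk_inner_comb[OF v c(1)] rk_inner_cnj[OF v kc] by simp
    then have "L g - rk_inner g v = L (\<lambda>w. g w - comb c w) - rk_inner (\<lambda>w. g w - comb c w) v"
      using lin[OF g kc, of 1 "-1"] rk_inner_lin[OF g kc v, of 1 "-1"] by simp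
    also have "cmod \<dots> \<le> cmod (L (\<lambda>w. g w - comb c w)) + cmod (rk_inner (\<lambda>w. g w - comb c w) v)"
      by (rule norm_triangle_ineq4)
    also have "\<dots> \<le> \<bar>C\<bar> * rk_norm (\<lambda>w. g w - comb c w) + rk_norm (\<lambda>w. g w - comb c w) * rk_norm v"
      by (intro add_mono bd' rk_inner_bound gc v)
    also have "\<dots> \<le> rk_norm (\<lambda>w. g w - comb c w) * r"
      using rk_norm_nonneg[OF gc] by (simp add: r_def algebra_simps)
    also have "\<dots> \<le> e / r * r" using c(2) r by (intro mult_right_mono) auto
    finally show ?thesis using r by simp
  qed
  then have "cmod (L g - rk_inner g v) \<le> 0" by (rule field_le_epsilon) simp
  then show "L g = rk_inner g v" by simp
qed

end

section \<open>Potentials of measures of finite energy\<close>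

locale metric_kernel = psd_kernel +
  assumes metric: "Metric_space UNIV (dk k)"
begin

section \<open>Measurability for the Borel sets of the kernel metric\<close>

lemma borel_k_openin: "openin (Metric_space.mtopology UNIV (dk k)) U \<Longrightarrow> U \<in> borel_k k"
  unfolding borel_k_def by (rule sigma_sets.Basic) simp

lemma Lipschitz_borel_measurable:
  fixes f :: "'a \<Rightarrow> complex"
  assumes f: "\<And>s t. cmod (f s - f t) \<le> C * dk k s t"
    and M: "sets M = borel_k k" "space M = UNIV"
  shows "f \<in> borel_measurable M"
proof (rule borel_measurableI)
  interpret Metric_space UNIV "dk k" by (rule metric)
  fix S :: "complex set" assume S: "open S"
  have "openin mtopology (f -` S)"
    unfolding openin_mtopology
  proof (intro conjI allI impI)
    fix x assume "x \<in> f -` S"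
    then obtain e where e: "e > 0" "ball (f x) e \<subseteq> S" using S by (auto simp: open_contains_ball)
    define r where "r = e / (\<bar>C\<bar> + 1)"
    have "mball x r \<subseteq> f -` S"
    proof
      fix y assume "y \<in> mball x r"
      then have d: "dk k x y < r" by simp
      have "cmod (f x - f y) \<le> (\<bar>C\<bar> + 1) * dk k x y"
        using f[of x y] mult_right_mono[of C "\<bar>C\<bar> + 1" "dk k x y"] nonneg[of x y] by linarith
      also have "\<dots> < (\<bar>C\<bar> + 1) * r" using d by (intro mult_strict_left_mono) auto
      also have "\<dots> = e" by (simp add: r_def)
      finally show "y \<in> f -` S" using e(2) by (auto simp: dist_norm)
    qed
    moreover have "r > 0" using e(1) by (simp add: r_def)
    ultimately show "\<exists>r>0. mball x r \<subseteq> f -` S" by blast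
  qed simp
  then show "f -` S \<inter> space M \<in> sets M" using borel_k_openin M by simp
qed

lemma rk_space_measurable:
  "g \<in> rk_space \<Longrightarrow> sets M = borel_k k \<Longrightarrow> space M = UNIV \<Longrightarrow> g \<in> borel_measurable M"
  by (rule Lipschitz_borel_measurable[OF rk_space_Lipschitz])

lemma dk_measurable:
  assumes "sets M = borel_k k" "space M = UNIV"
  shows "(\<lambda>t. dk k s t) \<in> borel_measurable M"
proof -
  interpret Metric_space UNIV "dk k" by (rule metric)
  have "cmod (of_real (dk k s t) - of_real (dk k s t')) \<le> 1 * dk k t t'" for t t'
    using triangle[of s t t'] triangle[of s t' t] commute[of t t'] by (simp flip: of_real_diff)
  from Lipschitz_borel_measurable[of "\<lambda>t. of_real (dk k s t)", OF this assms]
  have "(\<lambda>t. Re (of_real (dk k s t))) \<in> borel_measurable M" by measurable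
  then show ?thesis by simp
qed

lemma dk_zero: "dk k s t = 0 \<longleftrightarrow> s = t"
proof -
  interpret Metric_space UNIV "dk k" by (rule metric)
  show ?thesis by simp
qed

lemma singleton_borel_k: "{s} \<in> borel_k k"
proof -
  let ?N = "sigma UNIV {U. openin (Metric_space.mtopology UNIV (dk k)) U}"
  have N: "sets ?N = borel_k k" "space ?N = UNIV" by (simp_all add: borel_k_def)
  have "(\<lambda>t. dk k s t) -` {0} \<inter> space ?N \<in> sets ?N"
    by (rule measurable_sets[OF dk_measurable[OF N]]) simp
  moreover have "(\<lambda>t. dk k s t) -` {0} \<inter> space ?N = {s}" using dk_zero by auto
  ultimately show ?thesis using N by simp
qed

lemma kernel_measurable:
  assumes "sets M = borel_k k" "space M = UNIV"
  shows "(\<lambda>t. k t s) \<in> borel_measurable M" "(\<lambda>t. k s t) \<in> borel_measurable M"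
proof -
  show 1: "(\<lambda>t. k t s) \<in> borel_measurable M"
    by (rule rk_space_measurable[OF kernel_in_rk_space assms])
  have "(\<lambda>t. k s t) = (\<lambda>t. cnj (k t s))" by (intro ext herm)
  then show "(\<lambda>t. k s t) \<in> borel_measurable M" using borel_measurable_cnj[OF 1] by simp
qed

text \<open>The iterated integral bounds \<open>\<integral>|g| dT\<close> although \<open>\<integral>\<surd>k(t,t) dT(t)\<close> may be infinite: on balls
  the functional \<open>f \<mapsto> \<integral> f cnj(sgn g) dT\<close> is bounded, so it is represented by an element \<open>v\<close> of the
  space, and \<open>|v|\<^sup>2\<close> is a double integral of the kernel against unimodular factors. Only iterated integrals
  occur, as \<open>k\<close> need not be measurable for the product \<open>\<sigma>\<close>-algebra in the nonseparable case.\<close>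

lemma rk_space_integrable:
  assumes T: "finite_measure T" "sets T = borel_k k" "space T = UNIV"
    and K: "(\<integral>\<^sup>+s. \<integral>\<^sup>+t. norm (k s t) \<partial>T \<partial>T) \<le> ennreal K" "0 \<le> K"
    and g: "g \<in> rk_space"
  shows "integrable T g" "(\<integral>t. norm (g t) \<partial>T) \<le> sqrt K * rk_norm g"
proof -
  interpret T: finite_measure T by (rule T)
  note g_meas[measurable] = rk_space_measurable[OF g T(2,3)]
  define s0 :: 'a where "s0 = undefined"
  define A where "A n = {t. dk k s0 t \<le> real n}" for n
  have A_meas[measurable]: "A n \<in> sets T" for n
  proof -
    have "(\<lambda>t. dk k s0 t) -` {..real n} \<inter> space T \<in> sets T"
      by (rule measurable_sets[OF dk_measurable[OF T(2,3)]]) simp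
    then show ?thesis by (simp add: A_def vimage_def T)
  qed
  have trunc: "(\<integral>\<^sup>+t. norm (g t) * indicator (A n) t \<partial>T) \<le> ennreal (sqrt K * rk_norm g)" for n
  proof -
    \<comment> \<open>Against this factor, bounded by 1, the integral of \<open>g\<close> becomes
      the integral of |g| over the ball \<open>A n\<close>.\<close>
    define e where "e t = indicator (A n) t * cnj (sgn (g t))" for t
    have [measurable]: "e \<in> borel_measurable T" unfolding e_def sgn_div_norm by measurable
    have e1: "norm (e t) \<le> 1" for t by (simp add: e_def norm_mult norm_sgn indicator_def)
    define L where "L f = (\<integral>t. e t * f t \<partial>T)" for f :: "'a \<Rightarrow> complex"
    \<comment> \<open>Per unit of norm: the bound for the value at the centre plus the Lipschitz
      variation over a ball of radius n.\<close>
    define c where "c = sqrt (Re (k s0 s0)) + real n"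
    have bd: "norm (e t * f t) \<le> c * rk_norm f" if f: "f \<in> rk_space" for f t
    proof (cases "t \<in> A n")
      case True
      have "norm (e t * f t) \<le> 1 * norm (f t)"
        unfolding norm_mult by (intro mult_right_mono e1) simp
      also have "\<dots> \<le> norm (f s0) + norm (f s0 - f t)"
        using norm_triangle_sub[of "f t" "f s0"] by (simp add: norm_minus_commute)
      also have "\<dots> \<le> rk_norm f * sqrt (Re (k s0 s0)) + rk_norm f * dk k s0 t"
        by (intro add_mono rk_space_eval_bound rk_space_Lipschitz f)
      also have "\<dots> \<le> rk_norm f * sqrt (Re (k s0 s0)) + rk_norm f * real n"
        using True by (intro add_left_mono mult_left_mono rk_norm_nonneg f) (simp add: A_def)
      finally show ?thesis by (simp add: c_def algebra_simps)
    next
      case False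
      then show ?thesis using kernel_diag_nonneg[of s0] rk_norm_nonneg[OF f] by (simp add: e_def c_def)
    qed
    have int: "integrable T (\<lambda>t. e t * f t)" if f: "f \<in> rk_space" for f
      using bd[OF f] rk_space_measurable[OF f T(2,3)]
      by (intro T.integrable_const_bound[of _ "c * rk_norm f"]) auto
    have lin: "L (\<lambda>w. a * f w + b * f' w) = a * L f + b * L f'" if f: "f \<in> rk_space" "f' \<in> rk_space" for f f' a b
    proof -
      have "L (\<lambda>w. a * f w + b * f' w) = (\<integral>t. a * (e t * f t) + b * (e t * f' t) \<partial>T)"
        unfolding L_def by (rule Bochner_Integration.integral_cong) (simp_all add: algebra_simps)
      then show ?thesis unfolding L_def using int[OF f(1)] int[OF f(2)] by simp
    qed
    \<comment> \<open>This bound grows with n. It makes Riesz representation applicable; the bound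
      uniform in n is extracted from the representer afterwards.\<close>
    have bdL: "cmod (L f) \<le> (c * measure T (space T)) * rk_norm f" if f: "f \<in> rk_space" for f
    proof -
      have "cmod (L f) \<le> (\<integral>t. norm (e t * f t) \<partial>T)"
        unfolding L_def by (rule integral_norm_bound)
      also have "\<dots> \<le> (\<integral>t. c * rk_norm f \<partial>T)" using int[OF f] bd[OF f] by (intro integral_mono) auto
      finally show ?thesis by (simp add: algebra_simps)
    qed
    define v where "v = (\<lambda>s. cnj (L (\<lambda>t. k t s)))"
    have v: "v \<in> rk_space"
      unfolding v_def by (rule rk_Riesz(1)[OF lin bdL])
    have Lv: "L f = rk_inner f v" if "f \<in> rk_space" for f
      unfolding v_def by (rule rk_Riesz(2)[OF lin bdL that])
    have norm_L: "ennreal (cmod (L f)) \<le> (\<integral>\<^sup>+t. norm (f t) \<partial>T)" if f: "f \<in> rk_space" for f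
    proof -
      have "ennreal (cmod (L f)) \<le> (\<integral>\<^sup>+t. norm (e t * f t) \<partial>T)"
        unfolding L_def by (rule integral_norm_bound_ennreal[OF int[OF f]])
      also have "\<dots> \<le> (\<integral>\<^sup>+t. norm (f t) \<partial>T)"
        using mult_right_mono[OF e1 norm_ge_zero[of "f _"]]
        by (intro nn_integral_mono ennreal_leI) (simp add: norm_mult mult_left_le_one_le e1)
      finally show ?thesis .
    qed
    \<comment> \<open>The representer is tested on itself: |v|^2 = L v is at most the integral of
      |v|, and v(s) is in turn at most the integral of |k(s,t)| over t in absolute value, so K alone
      controls the norm.\<close>
    have "ennreal ((rk_norm v)\<^sup>2) = ennreal (cmod (L v))"
      using Lv[OF v] rk_inner_self[OF v] by (simp add: norm_power)
    also have "\<dots> \<le> (\<integral>\<^sup>+s. norm (v s) \<partial>T)" by (rule norm_L[OF v])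
    also have "\<dots> \<le> (\<integral>\<^sup>+s. \<integral>\<^sup>+t. norm (k s t) \<partial>T \<partial>T)"
    proof (rule nn_integral_mono)
      fix s
      have "norm (k t s) = norm (k s t)" for t by (subst herm) simp
      then show "ennreal (norm (v s)) \<le> (\<integral>\<^sup>+t. norm (k s t) \<partial>T)"
        using norm_L[OF kernel_in_rk_space[of s]] by (simp add: v_def)
    qed
    also note K(1)
    finally have "(rk_norm v)\<^sup>2 \<le> K" using K(2) by simp
    then have v_le: "rk_norm v \<le> sqrt K" by (rule real_le_rsqrt)
    have eg: "e t * g t = of_real (norm (g t) * indicator (A n) t)" for t
    proof -
      have "cnj (sgn (g t)) * g t = of_real (norm (g t))"
        unfolding sgn_eq
        by (cases "g t = 0") (simp_all add: field_simps complex_norm_square[symmetric] power2_eq_square)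
      then show ?thesis by (simp add: e_def indicator_def)
    qed
    have int': "integrable T (\<lambda>t. norm (g t) * indicator (A n) t)"
      using integrable_Re[OF int[OF g]] by (simp only: eg Re_complex_of_real)
    have "(\<integral>\<^sup>+t. norm (g t) * indicator (A n) t \<partial>T) = ennreal (\<integral>t. norm (g t) * indicator (A n) t \<partial>T)"
      using int' by (intro nn_integral_eq_integral) auto
    also have "(\<integral>t. norm (g t) * indicator (A n) t \<partial>T) = cmod (L g)"
    proof -
      have "L g = of_real (\<integral>t. norm (g t) * indicator (A n) t \<partial>T)"
        unfolding L_def eg by (rule integral_of_real[OF int'])
      moreover have "0 \<le> (\<integral>t. norm (g t) * indicator (A n) t \<partial>T)" by (intro integral_nonneg_AE) auto
      ultimately show ?thesis by simp
    qed
    also have "cmod (L g) \<le> rk_norm g * sqrt K"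
      using Lv[OF g] rk_inner_bound[OF g v] mult_left_mono[OF v_le rk_norm_nonneg[OF g]] by simp
    finally show ?thesis by (simp add: mult.commute ennreal_leI)
  qed
  have lim: "(\<lambda>n. \<integral>\<^sup>+t. ennreal (norm (g t) * indicator (A n) t) \<partial>T) \<longlonglongrightarrow> (\<integral>\<^sup>+t. norm (g t) \<partial>T)"
  proof (rule nn_integral_LIMSEQ)
    show "incseq (\<lambda>n t. ennreal (norm (g t) * indicator (A n) t))"
      by (auto simp: incseq_def le_fun_def indicator_def A_def intro!: ennreal_leI)
    fix t
    show "(\<lambda>n. ennreal (norm (g t) * indicator (A n) t)) \<longlonglongrightarrow> ennreal (norm (g t))"
    proof (rule tendsto_eventually)
      obtain N where N: "dk k s0 t \<le> real N" using real_arch_simple by blast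
      have "ennreal (norm (g t) * indicator (A n) t) = ennreal (norm (g t))" if "n \<ge> N" for n
        using N that by (simp add: A_def indicator_def)
      then show "\<forall>\<^sub>F n in sequentially. ennreal (norm (g t) * indicator (A n) t) = ennreal (norm (g t))"
        by (rule eventually_sequentiallyI)
    qed
  qed simp
  have le: "(\<integral>\<^sup>+t. norm (g t) \<partial>T) \<le> ennreal (sqrt K * rk_norm g)"
    using trunc by (intro LIMSEQ_le_const2[OF lim]) auto
  show gi: "integrable T g"
    unfolding integrable_iff_bounded using g_meas le le_less_trans by fastforce
  have "ennreal (\<integral>t. norm (g t) \<partial>T) = (\<integral>\<^sup>+t. norm (g t) \<partial>T)"
    using gi by (intro nn_integral_eq_integral[symmetric]) auto
  then show "(\<integral>t. norm (g t) \<partial>T) \<le> sqrt K * rk_norm g"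
    using le K(2) rk_norm_nonneg[OF g]
    by (metis ennreal_le_iff mult_nonneg_nonneg real_sqrt_ge_zero)
qed

text \<open>Finite energy is witnessed by a single representation. Independence carries
  integrability and value over to all pairs of representations, so exactly one number satisfies the
  description in \<open>kform\<close>.\<close>

lemma M1_kernel_integral:
  assumes \<xi>: "M1 k \<xi>" and rep: "cm_rep (borel_k k) \<xi> \<mu> h"
  shows "has_bochner_integral (completion (\<mu> \<Otimes>\<^sub>M \<mu>))
    (\<lambda>z. cnj (h (fst z)) * k (fst z) (snd z) * h (snd z)) (kform k \<xi> \<xi>)"
proof -
  obtain \<mu>' h' where rep': "cm_rep (borel_k k) \<xi> \<mu>' h'"
      and int: "integrable (completion (\<mu>' \<Otimes>\<^sub>M \<mu>')) (\<lambda>p. cnj (h' (fst p)) * k (fst p) (snd p) * h' (snd p))"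
    using \<xi> by (auto simp: M1_def)
  define v where "v = (\<integral>p. cnj (h' (fst p)) * k (fst p) (snd p) * h' (snd p) \<partial>completion (\<mu>' \<Otimes>\<^sub>M \<mu>'))"
  have all: "has_bochner_integral (completion (\<nu> \<Otimes>\<^sub>M \<tau>)) (\<lambda>p. cnj (g (fst p)) * k (fst p) (snd p) * f (snd p)) v"
    if "cm_rep (borel_k k) \<xi> \<tau> f" "cm_rep (borel_k k) \<xi> \<nu> g" for \<tau> f \<nu> g
    using kernel_integral_rep_independent[OF rep' that(1) rep' that(2), of k v] int
    by (simp add: v_def has_bochner_integral_iff)
  have "kform k \<xi> \<xi> = v"
    unfolding kform_def
  proof (rule the_equality)
    show "\<forall>\<mu> h \<nu> g. cm_rep (borel_k k) \<xi> \<mu> h \<longrightarrow> cm_rep (borel_k k) \<xi> \<nu> g \<longrightarrow>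
       v = (\<integral>p. cnj (g (fst p)) * k (fst p) (snd p) * h (snd p) \<partial>completion (\<nu> \<Otimes>\<^sub>M \<mu>))"
      by (intro allI impI has_bochner_integral_integral_eq[OF all, symmetric])
  qed (use rep' in \<open>auto simp: v_def\<close>)
  then show ?thesis using all[OF rep rep] by simp
qed

text \<open>The integral of \<open>g\<close> against the conjugate of \<open>\<xi>\<close>: linear
  in \<open>g\<close>, antilinear in \<open>\<xi>\<close>. With the conjugation outside, the inner
  integrand is a function times \<open>h\<close>, the form covered by the linearity rule for
  representations.\<close>

definition dual_pair :: "('a set \<Rightarrow> complex) \<Rightarrow> ('a \<Rightarrow> complex) \<Rightarrow> complex" where
  "dual_pair \<xi> g = (case (SOME (\<mu>, h). cm_rep (borel_k k) \<xi> \<mu> h) of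
     (\<mu>, h) \<Rightarrow> cnj (\<integral>x. cnj (g x) * h x \<partial>\<mu>))"

text \<open>The potential of \<open>\<xi>\<close>, written in the shape in which Riesz
  representation delivers the representer of \<open>dual_pair \<xi>\<close>.\<close>

definition rk_embed :: "('a set \<Rightarrow> complex) \<Rightarrow> 'a \<Rightarrow> complex" where
  "rk_embed \<xi> = (\<lambda>s. cnj (dual_pair \<xi> (\<lambda>t. k t s)))"

lemma integrable_cnj_mult_density:
  assumes rep: "cm_rep (borel_k k) \<xi> \<mu> h" and g: "g \<in> rk_space"
  shows "integrable \<mu> (\<lambda>x. cnj (g x) * h x) \<longleftrightarrow> integrable (density \<mu> (\<lambda>x. norm (h x))) g"
proof -
  note R = cm_repD[OF rep]
  note [measurable] = cm_rep_measurable[OF rep] rk_space_measurable[OF g R(2,1)]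
  have "integrable (density \<mu> (\<lambda>x. norm (h x))) g \<longleftrightarrow> integrable \<mu> (\<lambda>x. norm (h x) *\<^sub>R g x)"
    by (rule integrable_density) auto
  also have "\<dots> \<longleftrightarrow> integrable \<mu> (\<lambda>x. norm (norm (h x) *\<^sub>R g x))" by (rule integrable_norm_iff[symmetric]) measurable
  also have "(\<lambda>x. norm (norm (h x) *\<^sub>R g x)) = (\<lambda>x. norm (cnj (g x) * h x))"
    by (auto simp: norm_mult mult.commute)
  also have "integrable \<mu> \<dots> \<longleftrightarrow> integrable \<mu> (\<lambda>x. cnj (g x) * h x)" by (rule integrable_norm_iff) measurable
  finally show ?thesis by simp
qed

text \<open>The integrand is replaced by a function \<open>F\<close> measurable on the product of
  the total variation with itself. The phase being unimodular, Tonelli for |F| bounds the iterated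
  integral of |k|, and Fubini for \<open>F\<close> turns the energy into an iterated
  integral.\<close>

lemma M1_rep:
  assumes \<xi>: "M1 k \<xi>" and rep: "cm_rep (borel_k k) \<xi> \<mu> h"
  defines "T \<equiv> density \<mu> (\<lambda>x. norm (h x))" and "u \<equiv> \<lambda>x. sgn (h x)"
  shows M1_integrable_abs: "\<exists>K\<ge>0. \<forall>g\<in>rk_space. integrable T g \<and> (\<integral>t. norm (g t) \<partial>T) \<le> sqrt K * rk_norm g"
    and M1_Fubini: "\<And>v. v \<in> rk_space \<Longrightarrow> (\<And>s. v s = (\<integral>t. k s t * u t \<partial>T)) \<Longrightarrow>
        (\<integral>s. cnj (u s) * v s \<partial>T) = kform k \<xi> \<xi>"
proof -
  note P = cm_rep_polar[OF rep, folded T_def u_def]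
  note R = cm_repD[OF P]
  interpret T: finite_measure T by (rule R)
  interpret TT: pair_sigma_finite T T by standard
  note [measurable] = cm_rep_measurable[OF P] kernel_measurable[OF R(2,1)]
  have u1: "AE x in T. norm (u x) = 1"
    unfolding T_def u_def by (rule AE_norm_sgn_density[OF cm_rep_measurable[OF rep]])
  obtain F where F: "has_bochner_integral (T \<Otimes>\<^sub>M T) F (kform k \<xi> \<xi>)"
      and AE: "AE z in T \<Otimes>\<^sub>M T. cnj (u (fst z)) * k (fst z) (snd z) * u (snd z) = F z"
    using M1_kernel_integral[OF \<xi> P] unfolding has_bochner_integral_completion_iff by blast
  have F_int: "integrable (T \<Otimes>\<^sub>M T) F" using F by (simp add: has_bochner_integral_iff)
  then have [measurable]: "F \<in> borel_measurable (T \<Otimes>\<^sub>M T)" by simp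
  have AE2: "AE s in T. AE t in T. cnj (u s) * k s t * u t = F (s, t)"
    using TT.AE_pair[OF AE] by simp
  \<comment> \<open>The absolute energy of \<open>\<xi>\<close>: |F| is almost everywhere |k|, and T
    is the total variation.\<close>
  define K where "K = (\<integral>z. norm (F z) \<partial>(T \<Otimes>\<^sub>M T))"
  have K0: "0 \<le> K" by (simp add: K_def)
  have "(\<integral>\<^sup>+s. \<integral>\<^sup>+t. norm (k s t) \<partial>T \<partial>T) = (\<integral>\<^sup>+s. \<integral>\<^sup>+t. norm (F (s, t)) \<partial>T \<partial>T)"
  proof (rule nn_integral_cong_AE)
    show "AE s in T. (\<integral>\<^sup>+t. norm (k s t) \<partial>T) = (\<integral>\<^sup>+t. norm (F (s, t)) \<partial>T)"
      using AE2 u1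
    proof eventually_elim
      case (elim s)
      show ?case
      proof (rule nn_integral_cong_AE)
        show "AE t in T. ennreal (norm (k s t)) = ennreal (norm (F (s, t)))"
          using elim(1) u1
        proof eventually_elim
          case (elim t)
          show ?case by (simp add: elim(1)[symmetric] norm_mult elim(2) \<open>norm (u s) = 1\<close>)
        qed
      qed
    qed
  qed
  also have "\<dots> = (\<integral>\<^sup>+z. norm (F z) \<partial>(T \<Otimes>\<^sub>M T))" by (rule T.nn_integral_fst) measurable
  also have "\<dots> = ennreal K" unfolding K_def using F_int by (intro nn_integral_eq_integral) auto
  finally have K: "(\<integral>\<^sup>+s. \<integral>\<^sup>+t. norm (k s t) \<partial>T \<partial>T) \<le> ennreal K" by simp
  show "\<exists>K\<ge>0. \<forall>g\<in>rk_space. integrable T g \<and> (\<integral>t. norm (g t) \<partial>T) \<le> sqrt K * rk_norm g"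
    using rk_space_integrable[OF R(3,2,1) K K0] K0 by blast
  fix v assume v: "v \<in> rk_space" "\<And>s. v s = (\<integral>t. k s t * u t \<partial>T)"
  note [measurable] = rk_space_measurable[OF v(1) R(2,1)]
  have "kform k \<xi> \<xi> = integral\<^sup>L (T \<Otimes>\<^sub>M T) F" using F by (simp add: has_bochner_integral_iff)
  also have "\<dots> = (\<integral>s. \<integral>t. F (s, t) \<partial>T \<partial>T)" by (rule TT.integral_fst'[OF F_int, symmetric])
  also have "\<dots> = (\<integral>s. cnj (u s) * v s \<partial>T)"
  proof (rule integral_cong_AE)
    show "AE s in T. (\<integral>t. F (s, t) \<partial>T) = cnj (u s) * v s"
      using AE2
    proof eventually_elim
      case (elim s)
      have "(\<integral>t. F (s, t) \<partial>T) = (\<integral>t. cnj (u s) * (k s t * u t) \<partial>T)"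
      proof (rule integral_cong_AE)
        show "AE t in T. F (s, t) = cnj (u s) * (k s t * u t)"
          using elim by eventually_elim (simp add: mult.assoc)
        show "(\<lambda>t. F (s, t)) \<in> borel_measurable T"
          using R(1) by (intro measurable_compose[OF measurable_Pair1'[of s T T]]) simp_all
        show "(\<lambda>t. cnj (u s) * (k s t * u t)) \<in> borel_measurable T"
          by (intro borel_measurable_times borel_measurable_const kernel_measurable(2)[OF R(2,1)] cm_rep_measurable[OF P])
      qed
      then show ?case by (simp add: v(2))
    qed
  qed measurable
  finally show "(\<integral>s. cnj (u s) * v s \<partial>T) = kform k \<xi> \<xi>" by simp
qed

lemma M1_integrable:
  assumes "M1 k \<xi>" "cm_rep (borel_k k) \<xi> \<mu> h" "g \<in> rk_space"
  shows "integrable \<mu> (\<lambda>x. cnj (g x) * h x)"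
  using M1_integrable_abs[OF assms(1,2)] integrable_cnj_mult_density[OF assms(2,3)] assms(3) by auto

lemma M1_ex_rep: "M1 k \<xi> \<Longrightarrow> \<exists>\<mu> h. cm_rep (borel_k k) \<xi> \<mu> h"
  by (auto simp: M1_def)

lemma dual_pair_eq:
  assumes \<xi>: "M1 k \<xi>" and rep: "cm_rep (borel_k k) \<xi> \<mu> h" and g: "g \<in> rk_space"
  shows "dual_pair \<xi> g = cnj (\<integral>x. cnj (g x) * h x \<partial>\<mu>)"
proof -
  obtain \<mu>' h' where *: "(SOME (\<mu>, h). cm_rep (borel_k k) \<xi> \<mu> h) = (\<mu>', h')" by (cases "SOME (\<mu>, h). cm_rep (borel_k k) \<xi> \<mu> h")
  have "case (SOME (\<mu>, h). cm_rep (borel_k k) \<xi> \<mu> h) of (\<mu>, h) \<Rightarrow> cm_rep (borel_k k) \<xi> \<mu> h"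
    by (rule someI[of "\<lambda>(\<mu>, h). cm_rep (borel_k k) \<xi> \<mu> h" "(\<mu>, h)"]) (simp add: rep)
  then have rep': "cm_rep (borel_k k) \<xi> \<mu>' h'" by (simp add: *)
  have "(\<lambda>x. cnj (g x)) \<in> borel_measurable \<mu>"
    by (rule borel_measurable_cnj[OF rk_space_measurable[OF g cm_repD(2,1)[OF rep]]])
  from cm_rep_integral_unique[OF rep rep' this M1_integrable[OF \<xi> rep g] M1_integrable[OF \<xi> rep' g]]
  show ?thesis by (simp add: dual_pair_def *)
qed

text \<open>The bound by the absolute energy makes Riesz representation applicable, and the
  representer is the potential. By Fubini the energy is then \<open>dual_pair \<xi>\<close> applied
  to that potential, which is the squared norm of the representer.\<close>

lemma dual_pair_rk_inner:
  assumes \<xi>: "M1 k \<xi>"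
  shows rk_embed_in_rk_space: "rk_embed \<xi> \<in> rk_space"
    and "\<And>g. g \<in> rk_space \<Longrightarrow> dual_pair \<xi> g = rk_inner g (rk_embed \<xi>)"
    and kform_rk_embed: "kform k \<xi> \<xi> = of_real ((rk_norm (rk_embed \<xi>))\<^sup>2)"
proof -
  obtain \<mu> h where rep: "cm_rep (borel_k k) \<xi> \<mu> h" using M1_ex_rep[OF \<xi>] by blast
  define T where "T = density \<mu> (\<lambda>x. norm (h x))"
  define u where "u = (\<lambda>x. sgn (h x))"
  note P = cm_rep_polar[OF rep, folded T_def u_def]
  note R = cm_repD[OF P]
  note [measurable] = cm_rep_measurable[OF P]
  have u1: "norm (u x) \<le> 1" for x by (simp add: u_def norm_sgn)
  obtain K where K: "0 \<le> K" "\<And>g. g \<in> rk_space \<Longrightarrow> integrable T g"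
      "\<And>g. g \<in> rk_space \<Longrightarrow> (\<integral>t. norm (g t) \<partial>T) \<le> sqrt K * rk_norm g"
    using M1_integrable_abs[OF \<xi> rep] unfolding T_def by blast
  have dp: "dual_pair \<xi> g = (\<integral>x. cnj (u x) * g x \<partial>T)" if "g \<in> rk_space" for g
  proof -
    have "dual_pair \<xi> g = (\<integral>x. cnj (cnj (g x) * u x) \<partial>T)"
      unfolding dual_pair_eq[OF \<xi> P that] by (rule Bochner_Integration.integral_cnj[symmetric])
    then show ?thesis by (simp only: complex_cnj_mult complex_cnj_cnj mult.commute)
  qed
  have ui: "integrable T (\<lambda>x. cnj (u x) * g x)" if "g \<in> rk_space" for g
    using integrable_cnj[OF M1_integrable[OF \<xi> P that]] by (simp add: mult.commute)
  have lin: "dual_pair \<xi> (\<lambda>w. a * g w + b * g' w) = a * dual_pair \<xi> g + b * dual_pair \<xi> g'"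
    if g: "g \<in> rk_space" "g' \<in> rk_space" for g g' a b
  proof -
    have "dual_pair \<xi> (\<lambda>w. a * g w + b * g' w) = (\<integral>x. a * (cnj (u x) * g x) + b * (cnj (u x) * g' x) \<partial>T)"
      unfolding dp[OF rk_space_lin(1)[OF g]] by (rule Bochner_Integration.integral_cong) (simp_all add: algebra_simps)
    then show ?thesis using ui[OF g(1)] ui[OF g(2)] by (simp add: dp g)
  qed
  have bd: "cmod (dual_pair \<xi> g) \<le> sqrt K * rk_norm g" if g: "g \<in> rk_space" for g
  proof -
    have "cmod (dual_pair \<xi> g) \<le> (\<integral>x. norm (cnj (u x) * g x) \<partial>T)"
      unfolding dp[OF g] by (rule integral_norm_bound)
    also have "\<dots> \<le> (\<integral>x. norm (g x) \<partial>T)"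
    proof (rule integral_mono)
      show "norm (cnj (u x) * g x) \<le> norm (g x)" for x
        using mult_right_mono[OF u1[of x] norm_ge_zero[of "g x"]] by (simp add: norm_mult)
    qed (use ui[OF g] K(2)[OF g] in auto)
    finally show ?thesis using K(3)[OF g] by simp
  qed
  show v: "rk_embed \<xi> \<in> rk_space" unfolding rk_embed_def by (rule rk_Riesz(1)[OF lin bd])
  show L: "dual_pair \<xi> g = rk_inner g (rk_embed \<xi>)" if "g \<in> rk_space" for g
    unfolding rk_embed_def by (rule rk_Riesz(2)[OF lin bd that])
  have "rk_embed \<xi> s = (\<integral>t. k s t * u t \<partial>T)" for s
  proof -
    have "rk_embed \<xi> s = (\<integral>t. cnj (cnj (u t) * k t s) \<partial>T)"
      unfolding rk_embed_def dp[OF kernel_in_rk_space] Bochner_Integration.integral_cnj ..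
    also have "\<dots> = (\<integral>t. k s t * u t \<partial>T)"
      by (simp add: herm[symmetric] mult.commute)
    finally show ?thesis .
  qed
  then have "(\<integral>s. cnj (u s) * rk_embed \<xi> s \<partial>T) = kform k \<xi> \<xi>"
    unfolding T_def u_def by (intro M1_Fubini[OF \<xi> rep v]) simp
  then show "kform k \<xi> \<xi> = of_real ((rk_norm (rk_embed \<xi>))\<^sup>2)"
    using dp[OF v] L[OF v] rk_inner_self[OF v] by simp
qed

lemma dual_pair_bound:
  assumes "M1 k \<xi>" "g \<in> rk_space"
  shows "cmod (dual_pair \<xi> g) \<le> rk_norm g * sqrt (Re (kform k \<xi> \<xi>))"
  using dual_pair_rk_inner[OF assms(1)] assms(2) rk_inner_bound[OF assms(2)] rk_norm_nonneg by simp

lemma dual_pair_lin: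
  assumes "M1 k \<xi>" "M1 k \<eta>" "M1 k (\<lambda>A. a * \<xi> A + b * \<eta> A)" and g: "g \<in> rk_space"
  shows "dual_pair (\<lambda>A. a * \<xi> A + b * \<eta> A) g = cnj a * dual_pair \<xi> g + cnj b * dual_pair \<eta> g"
proof -
  obtain \<mu> h \<nu> f \<tau> w where rep: "cm_rep (borel_k k) \<xi> \<mu> h" "cm_rep (borel_k k) \<eta> \<nu> f"
      "cm_rep (borel_k k) (\<lambda>A. a * \<xi> A + b * \<eta> A) \<tau> w"
    using assms(1-3)[THEN M1_ex_rep] by blast
  have "(\<lambda>x. cnj (g x)) \<in> borel_measurable \<mu>"
    by (rule borel_measurable_cnj[OF rk_space_measurable[OF g cm_repD(2,1)[OF rep(1)]]])
  from cm_rep_integral_lin[OF rep refl this]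
  have "(\<integral>x. cnj (g x) * w x \<partial>\<tau>) = a * (\<integral>x. cnj (g x) * h x \<partial>\<mu>) + b * (\<integral>x. cnj (g x) * f x \<partial>\<nu>)"
    using M1_integrable[OF assms(1) rep(1) g] M1_integrable[OF assms(2) rep(2) g] M1_integrable[OF assms(3) rep(3) g]
    by simp
  then show ?thesis
    using dual_pair_eq[OF assms(1) rep(1) g] dual_pair_eq[OF assms(2) rep(2) g] dual_pair_eq[OF assms(3) rep(3) g]
    by simp
qed

section \<open>Dirac measures and the dual of the space of measures\<close>

text \<open>As the image of a one-point counting measure under a constant map, it inherits
  finiteness, and integrals reduce to one value.\<close>

definition point_mass :: "'a \<Rightarrow> 'a measure" where
  "point_mass x = distr (count_space (UNIV :: unit set))
     (sigma UNIV {U. openin (Metric_space.mtopology UNIV (dk k)) U}) (\<lambda>_. x)"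

lemma space_point_mass: "space (point_mass x) = UNIV"
  by (simp add: point_mass_def)

lemma sets_point_mass: "sets (point_mass x) = borel_k k"
  by (simp add: point_mass_def borel_k_def)

lemma finite_measure_point_mass: "finite_measure (point_mass x)"
  unfolding point_mass_def by (intro finite_measure.finite_measure_distr finite_measure_count_space) auto

lemma integral_point_mass:
  fixes f :: "'a \<Rightarrow> complex"
  assumes "f \<in> borel_measurable (point_mass x)"
  shows "(\<integral>t. f t \<partial>point_mass x) = f x"
proof -
  have "f \<in> borel_measurable (sigma UNIV {U. openin (Metric_space.mtopology UNIV (dk k)) U})"
    using assms by (simp add: point_mass_def)
  then show ?thesis
    unfolding point_mass_def by (subst integral_distr) (simp_all add: lebesgue_integral_count_space_finite UNIV_unit)
qed

lemma AE_point_mass: "AE t in point_mass x. t = x"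
  using singleton_borel_k[of x] unfolding point_mass_def borel_k_def by (subst AE_distr_iff) auto

lemma cm_rep_dirac: "cm_rep (borel_k k) (\<lambda>A. a * dirac_cm k x A) (point_mass x) (\<lambda>_. a)"
proof -
  interpret finite_measure "point_mass x" by (rule finite_measure_point_mass)
  have "a * dirac_cm k x A = set_lebesgue_integral (point_mass x) A (\<lambda>_. a)" if "A \<in> borel_k k" for A
  proof -
    have "(\<lambda>t. indicator A t *\<^sub>R a) \<in> borel_measurable (point_mass x)"
      using that by (intro borel_measurable_scaleR borel_measurable_indicator) (simp_all add: sets_point_mass)
    from integral_point_mass[OF this] show ?thesis
      using that by (simp add: dirac_cm_def set_lebesgue_integral_def indicator_def)
  qed
  then show ?thesis
    by (simp add: cm_rep_def space_point_mass sets_point_mass finite_measure_axioms)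
qed

lemma complex_measure_on_dirac: "complex_measure_on (borel_k k) (dirac_cm k x)"
  unfolding complex_measure_on_def
proof (intro conjI allI impI)
  fix A :: "nat \<Rightarrow> 'a set" assume A: "range A \<subseteq> borel_k k" and dis: "disjoint_family A"
  have U: "(\<Union>i. A i) \<in> borel_k k" using A unfolding borel_k_def by (intro sigma_sets.Union) auto
  show "(\<lambda>i. dirac_cm k x (A i)) sums dirac_cm k x (\<Union>i. A i)"
  proof (cases "x \<in> (\<Union>i. A i)")
    case True
    then obtain j where j: "x \<in> A j" by blast
    then have "dirac_cm k x (A i) = (if i = j then 1 else 0)" for i
      using A dis by (auto simp: dirac_cm_def disjoint_family_on_def)
    then show ?thesis using True U sums_single[of j "\<lambda>_. 1::complex"] by (simp add: dirac_cm_def)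
  next
    case False
    then show ?thesis by (simp add: dirac_cm_def)
  qed
qed (simp add: dirac_cm_def)

lemma complex_measure_on_add_mult:
  assumes "complex_measure_on B \<xi>" "complex_measure_on B \<eta>"
  shows "complex_measure_on B (\<lambda>A. \<xi> A + a * \<eta> A)"
  using assms unfolding complex_measure_on_def by (auto intro!: sums_add sums_mult)

lemma AE_pair_point_mass:
  assumes "finite_measure \<mu>"
  shows "AE z in \<mu> \<Otimes>\<^sub>M point_mass x. snd z = x" "AE z in point_mass x \<Otimes>\<^sub>M \<mu>. fst z = x"
proof -
  interpret \<mu>: finite_measure \<mu> by fact
  interpret P: finite_measure "point_mass x" by (rule finite_measure_point_mass)
  interpret MP: pair_sigma_finite \<mu> "point_mass x" by standard
  interpret PM: pair_sigma_finite "point_mass x" \<mu> by standard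
  have x: "{x} \<in> sets (point_mass x)" by (simp add: sets_point_mass singleton_borel_k)
  have "{z \<in> space (\<mu> \<Otimes>\<^sub>M point_mass x). snd z = x} = space \<mu> \<times> {x}"
    by (auto simp: space_pair_measure space_point_mass)
  then show "AE z in \<mu> \<Otimes>\<^sub>M point_mass x. snd z = x"
    using x AE_point_mass by (intro MP.AE_pair_measure) auto
  have "{z \<in> space (point_mass x \<Otimes>\<^sub>M \<mu>). fst z = x} = {x} \<times> space \<mu>"
    by (auto simp: space_pair_measure space_point_mass)
  then show "AE z in point_mass x \<Otimes>\<^sub>M \<mu>. fst z = x"
    using x AE_point_mass[of x] by (intro PM.AE_pair_measure) (auto elim!: eventually_mono)
qed

text \<open>Almost everywhere the second coordinate is \<open>x\<close>, so the kernel may be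
  replaced by its section at \<open>x\<close>, which is measurable even if the kernel is not jointly
  so.\<close>

lemma integrable_kernel_point_mass_right:
  assumes "finite_measure \<mu>" "integrable \<mu> (\<lambda>t. cnj (h t) * k t x)"
  shows "integrable (completion (\<mu> \<Otimes>\<^sub>M point_mass x)) (\<lambda>z. cnj (h (fst z)) * k (fst z) (snd z) * a)"
proof (rule integrable_completion_AE)
  interpret \<mu>: finite_measure \<mu> by fact
  interpret P: finite_measure "point_mass x" by (rule finite_measure_point_mass)
  interpret MP: pair_sigma_finite \<mu> "point_mass x" by standard
  show "integrable (\<mu> \<Otimes>\<^sub>M point_mass x) (\<lambda>z. (cnj (h (fst z)) * k (fst z) x) * a)"
    using assms(2) by (intro MP.integrable_mult_pair) auto
  show "AE z in \<mu> \<Otimes>\<^sub>M point_mass x. cnj (h (fst z)) * k (fst z) (snd z) * a = (cnj (h (fst z)) * k (fst z) x) * a"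
    using AE_pair_point_mass(1)[OF assms(1)] by eventually_elim simp
qed

lemma integrable_kernel_point_mass_left:
  assumes "finite_measure \<mu>" "integrable \<mu> (\<lambda>t. k x t * h t)"
  shows "integrable (completion (point_mass x \<Otimes>\<^sub>M \<mu>)) (\<lambda>z. a * k (fst z) (snd z) * h (snd z))"
proof (rule integrable_completion_AE)
  interpret \<mu>: finite_measure \<mu> by fact
  interpret P: finite_measure "point_mass x" by (rule finite_measure_point_mass)
  interpret PM: pair_sigma_finite "point_mass x" \<mu> by standard
  show "integrable (point_mass x \<Otimes>\<^sub>M \<mu>) (\<lambda>z. a * (k x (snd z) * h (snd z)))"
    using assms(2) by (intro PM.integrable_mult_pair) auto
  show "AE z in point_mass x \<Otimes>\<^sub>M \<mu>. a * k (fst z) (snd z) * h (snd z) = a * (k x (snd z) * h (snd z))"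
    using AE_pair_point_mass(2)[OF assms(1)] by eventually_elim simp
qed

lemma integrable_kernel_point_mass:
  "integrable (completion (point_mass x \<Otimes>\<^sub>M point_mass x)) (\<lambda>z. cnj a * k (fst z) (snd z) * a)"
proof -
  interpret P: finite_measure "point_mass x" by (rule finite_measure_point_mass)
  interpret PP: pair_sigma_finite "point_mass x" "point_mass x" by standard
  interpret finite_measure "point_mass x \<Otimes>\<^sub>M point_mass x"
    by (intro finite_measure_pair_measure finite_measure_point_mass)
  show ?thesis
  proof (rule integrable_completion_AE)
    show "integrable (point_mass x \<Otimes>\<^sub>M point_mass x) (\<lambda>_. cnj a * k x x * a)" by simp
    show "AE z in point_mass x \<Otimes>\<^sub>M point_mass x. cnj a * k (fst z) (snd z) * a = cnj a * k x x * a"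
      using AE_pair_point_mass[OF P.finite_measure_axioms] by eventually_elim simp
  qed
qed

lemma M1_dirac_scale: "M1 k (\<lambda>A. a * dirac_cm k x A)"
proof -
  have "complex_measure_on (borel_k k) (\<lambda>A. 0)" by (simp add: complex_measure_on_def)
  from complex_measure_on_add_mult[OF this complex_measure_on_dirac]
  have "complex_measure_on (borel_k k) (\<lambda>A. a * dirac_cm k x A)" by simp
  then show ?thesis
    unfolding M1_def using cm_rep_dirac integrable_kernel_point_mass by blast
qed

lemma M1_dirac: "M1 k (dirac_cm k x)"
  using M1_dirac_scale[of 1 x] by simp

lemma M1_zero: "M1 k (\<lambda>A. 0)"
  using M1_dirac_scale[of 0 undefined] by simp

text \<open>Over a common dominating measure the integrand splits into four terms. The energy of
  \<open>\<xi>\<close> is given, the pure Dirac term is treated over a product of point masses, and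
  the mixed terms are integrable because kernel sections lie in \<open>rk_space\<close>, whose
  elements \<open>\<xi>\<close> integrates.\<close>

lemma M1_add_dirac:
  assumes \<xi>: "M1 k \<xi>"
  shows "M1 k (\<lambda>A. \<xi> A + a * dirac_cm k x A)"
proof -
  obtain \<mu> h where rep: "cm_rep (borel_k k) \<xi> \<mu> h"
      and int: "integrable (completion (\<mu> \<Otimes>\<^sub>M \<mu>)) (\<lambda>p. cnj (h (fst p)) * k (fst p) (snd p) * h (snd p))"
    using \<xi> by (auto simp: M1_def)
  note R = cm_repD[OF rep] and D = cm_repD[OF cm_rep_dirac[of a x]]
  obtain \<tau> and p q :: "'a \<Rightarrow> real" where \<tau>: "finite_measure \<tau>" "sets \<tau> = sets \<mu>"
    "p \<in> borel_measurable \<tau>" "q \<in> borel_measurable \<tau>" "\<And>x. 0 \<le> p x" "\<And>x. 0 \<le> q x"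
    "density \<tau> p = \<mu>" "density \<tau> q = point_mass x"
    using common_dominating_measure[OF R(3) D(3)] R(2) D(2) by metis
  note [measurable] = \<tau>(3,4)
  have h_meas[measurable]: "h \<in> borel_measurable \<tau>"
    using cm_rep_measurable[OF rep] measurable_cong_sets[OF \<tau>(2), of borel borel] by auto
  define w where "w t = p t *\<^sub>R h t + q t *\<^sub>R a" for t
  have ph: "integrable \<tau> (\<lambda>t. p t *\<^sub>R h t)"
    using R(4) \<tau>(5) unfolding \<tau>(7)[symmetric] by (subst (asm) integrable_density) auto
  have qa: "integrable \<tau> (\<lambda>t. q t *\<^sub>R a)"
    using D(4) \<tau>(6) unfolding \<tau>(8)[symmetric] by (subst (asm) integrable_density) auto
  have "set_lebesgue_integral \<tau> A w = \<xi> A + a * dirac_cm k x A" if A: "A \<in> borel_k k" for A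
  proof -
    have [measurable]: "A \<in> sets \<tau>" using A R \<tau> by simp
    have "set_lebesgue_integral \<tau> A w =
        (\<integral>t. indicator A t *\<^sub>R (p t *\<^sub>R h t) + indicator A t *\<^sub>R (q t *\<^sub>R a) \<partial>\<tau>)"
      unfolding set_lebesgue_integral_def w_def scaleR_add_right ..
    also have "\<dots> = (\<integral>t. indicator A t *\<^sub>R (p t *\<^sub>R h t) \<partial>\<tau>) + (\<integral>t. indicator A t *\<^sub>R (q t *\<^sub>R a) \<partial>\<tau>)"
      by (intro Bochner_Integration.integral_add integrable_mult_indicator ph qa) measurable
    also have "(\<integral>t. indicator A t *\<^sub>R (p t *\<^sub>R h t) \<partial>\<tau>) = set_lebesgue_integral \<mu> A h"
      unfolding set_lebesgue_integral_def \<tau>(7)[symmetric] using \<tau>(5)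
      by (subst integral_density) (auto simp: scaleR_left_commute mult.commute)
    also have "(\<integral>t. indicator A t *\<^sub>R (q t *\<^sub>R a) \<partial>\<tau>) = set_lebesgue_integral (point_mass x) A (\<lambda>_. a)"
      unfolding set_lebesgue_integral_def \<tau>(8)[symmetric] using \<tau>(6)
      by (subst integral_density) (auto simp: scaleR_left_commute mult.commute)
    finally show ?thesis using R(5)[OF A] D(5)[OF A] by simp
  qed
  then have rep': "cm_rep (borel_k k) (\<lambda>A. \<xi> A + a * dirac_cm k x A) \<tau> w"
    using \<tau>(1,2) R(1,2) sets_eq_imp_space_eq[OF \<tau>(2)] ph qa by (simp add: cm_rep_def w_def[abs_def])
  \<comment> \<open>Each of the four terms is controlled over its own product of measures; here it
    moves to \<open>\<tau>\<close>, with the densities absorbed into the integrand.\<close>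
  have tr: "integrable (completion (\<tau> \<Otimes>\<^sub>M \<tau>))
      (\<lambda>z. cnj (r (fst z) *\<^sub>R f (fst z)) * k (fst z) (snd z) * (r' (snd z) *\<^sub>R f' (snd z)))"
    if "integrable (completion (density \<tau> r \<Otimes>\<^sub>M density \<tau> r')) (\<lambda>z. cnj (f (fst z)) * k (fst z) (snd z) * f' (snd z))"
      "r \<in> borel_measurable \<tau>" "r' \<in> borel_measurable \<tau>" "\<And>x. 0 \<le> r x" "\<And>x. 0 \<le> r' x"
      "finite_measure (density \<tau> r')" for r r' :: "'a \<Rightarrow> real" and f f' :: "'a \<Rightarrow> complex"
    by (rule integrable.intros[OF has_bochner_integral_completion_pair_density[OF that(2,3,4,5) \<tau>(1) that(6),
        THEN iffD1, OF has_bochner_integral_integrable[OF that(1)]]])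
  have hk: "integrable \<mu> (\<lambda>t. cnj (k t x) * h t)"
    by (rule M1_integrable[OF \<xi> rep kernel_in_rk_space])
  have hk': "integrable \<mu> (\<lambda>t. cnj (h t) * k t x)"
    using integrable_cnj[OF hk] by (simp add: mult.commute)
  have hk'': "integrable \<mu> (\<lambda>t. k x t * h t)"
    using hk by (simp add: herm[symmetric])
  have "integrable (completion (\<tau> \<Otimes>\<^sub>M \<tau>)) (\<lambda>z. cnj (p (fst z) *\<^sub>R h (fst z)) * k (fst z) (snd z) * (p (snd z) *\<^sub>R h (snd z)))"
    using int R(3) \<tau> by (intro tr) simp_all
  moreover have "integrable (completion (\<tau> \<Otimes>\<^sub>M \<tau>)) (\<lambda>z. cnj (p (fst z) *\<^sub>R h (fst z)) * k (fst z) (snd z) * (q (snd z) *\<^sub>R a))"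
    using integrable_kernel_point_mass_right[OF R(3) hk', of a] D(3) \<tau> by (intro tr) simp_all
  moreover have "integrable (completion (\<tau> \<Otimes>\<^sub>M \<tau>)) (\<lambda>z. cnj (q (fst z) *\<^sub>R a) * k (fst z) (snd z) * (p (snd z) *\<^sub>R h (snd z)))"
    using integrable_kernel_point_mass_left[OF R(3) hk'', of "cnj a"] R(3) \<tau> by (intro tr) simp_all
  moreover have "integrable (completion (\<tau> \<Otimes>\<^sub>M \<tau>)) (\<lambda>z. cnj (q (fst z) *\<^sub>R a) * k (fst z) (snd z) * (q (snd z) *\<^sub>R a))"
    using integrable_kernel_point_mass[of x a] D(3) \<tau> by (intro tr) simp_all
  ultimately have "integrable (completion (\<tau> \<Otimes>\<^sub>M \<tau>)) (\<lambda>z.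
      (cnj (p (fst z) *\<^sub>R h (fst z)) * k (fst z) (snd z) * (p (snd z) *\<^sub>R h (snd z)) +
       cnj (p (fst z) *\<^sub>R h (fst z)) * k (fst z) (snd z) * (q (snd z) *\<^sub>R a)) +
      (cnj (q (fst z) *\<^sub>R a) * k (fst z) (snd z) * (p (snd z) *\<^sub>R h (snd z)) +
       cnj (q (fst z) *\<^sub>R a) * k (fst z) (snd z) * (q (snd z) *\<^sub>R a)))"
    by (intro Bochner_Integration.integrable_add)
  also have "(\<lambda>z.
      (cnj (p (fst z) *\<^sub>R h (fst z)) * k (fst z) (snd z) * (p (snd z) *\<^sub>R h (snd z)) +
       cnj (p (fst z) *\<^sub>R h (fst z)) * k (fst z) (snd z) * (q (snd z) *\<^sub>R a)) +
      (cnj (q (fst z) *\<^sub>R a) * k (fst z) (snd z) * (p (snd z) *\<^sub>R h (snd z)) +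
       cnj (q (fst z) *\<^sub>R a) * k (fst z) (snd z) * (q (snd z) *\<^sub>R a))) =
      (\<lambda>z. cnj (w (fst z)) * k (fst z) (snd z) * w (snd z))"
    unfolding w_def complex_cnj_add distrib_left distrib_right by (simp only: ac_simps)
  finally have "integrable (completion (\<tau> \<Otimes>\<^sub>M \<tau>)) (\<lambda>z. cnj (w (fst z)) * k (fst z) (snd z) * w (snd z))" .
  moreover have "complex_measure_on (borel_k k) (\<lambda>A. \<xi> A + a * dirac_cm k x A)"
    using \<xi> by (intro complex_measure_on_add_mult complex_measure_on_dirac) (simp add: M1_def)
  ultimately show ?thesis unfolding M1_def using rep' by blast
qed

section \<open>Finite combinations of Dirac measures as measures of finite energy\<close>

definition dirac_comb :: "('a \<Rightarrow> complex) \<Rightarrow> 'a set \<Rightarrow> complex" where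
  "dirac_comb c A = (\<Sum>x | c x \<noteq> 0. c x * dirac_cm k x A)"

definition antilinear_M1 :: "(('a set \<Rightarrow> complex) \<Rightarrow> complex) \<Rightarrow> bool" where
  "antilinear_M1 f \<longleftrightarrow> (\<forall>\<xi> \<eta> a b. M1 k \<xi> \<longrightarrow> M1 k \<eta> \<longrightarrow> M1 k (\<lambda>A. a * \<xi> A + b * \<eta> A) \<longrightarrow>
     f (\<lambda>A. a * \<xi> A + b * \<eta> A) = cnj a * f \<xi> + cnj b * f \<eta>)"

lemma antilinear_M1D:
  "antilinear_M1 f \<Longrightarrow> M1 k \<xi> \<Longrightarrow> M1 k \<eta> \<Longrightarrow> M1 k (\<lambda>A. a * \<xi> A + b * \<eta> A) \<Longrightarrow>
    f (\<lambda>A. a * \<xi> A + b * \<eta> A) = cnj a * f \<xi> + cnj b * f \<eta>"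
  by (simp add: antilinear_M1_def)

lemma antilinear_M1_dual_pair: "g \<in> rk_space \<Longrightarrow> antilinear_M1 (\<lambda>\<xi>. dual_pair \<xi> g)"
  using dual_pair_lin by (auto simp: antilinear_M1_def)

text \<open>Antilinearity may be applied only when the combination again has finite energy; adding
  one Dirac measure at a time keeps every intermediate sum admissible.\<close>

lemma M1_add_dirac_sum:
  assumes \<xi>: "M1 k \<xi>" and "finite S"
  shows "M1 k (\<lambda>A. \<xi> A + (\<Sum>x\<in>S. c x * dirac_cm k x A)) \<and>
    (\<forall>f. antilinear_M1 f \<longrightarrow>
      f (\<lambda>A. \<xi> A + (\<Sum>x\<in>S. c x * dirac_cm k x A)) = f \<xi> + (\<Sum>x\<in>S. cnj (c x) * f (dirac_cm k x)))"
  using \<open>finite S\<close>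
proof (induction S rule: finite_induct)
  case empty
  then show ?case using \<xi> by simp
next
  case (insert y S)
  let ?\<eta> = "\<lambda>A. \<xi> A + (\<Sum>x\<in>S. c x * dirac_cm k x A)"
  have eq: "(\<lambda>A. \<xi> A + (\<Sum>x\<in>insert y S. c x * dirac_cm k x A)) = (\<lambda>A. ?\<eta> A + c y * dirac_cm k y A)"
    using insert by (auto simp: algebra_simps)
  have M: "M1 k ?\<eta>" using insert by blast
  have M': "M1 k (\<lambda>A. ?\<eta> A + c y * dirac_cm k y A)" by (rule M1_add_dirac[OF M])
  have "f (\<lambda>A. ?\<eta> A + c y * dirac_cm k y A) = f \<xi> + (\<Sum>x\<in>insert y S. cnj (c x) * f (dirac_cm k x))"
    if f: "antilinear_M1 f" for f
  proof -
    have "f (\<lambda>A. ?\<eta> A + c y * dirac_cm k y A) = f ?\<eta> + cnj (c y) * f (dirac_cm k y)"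
      using antilinear_M1D[OF f M M1_dirac, of 1 "c y" y] M' by simp
    then show ?thesis using insert f by (simp add: algebra_simps)
  qed
  with M' show ?case unfolding eq by blast
qed

lemma M1_add_dirac_comb:
  assumes "M1 k \<xi>" "c \<in> finsupp"
  shows "M1 k (\<lambda>A. \<xi> A + dirac_comb c A)"
    and "antilinear_M1 f \<Longrightarrow> f (\<lambda>A. \<xi> A + dirac_comb c A) = f \<xi> + pairing (\<lambda>s. f (dirac_cm k s)) c"
  using M1_add_dirac_sum[OF assms(1), of "{x. c x \<noteq> 0}" c] assms(2)
  by (simp_all add: finsupp_def dirac_comb_def pairing_def)

lemma dual_pair_dirac:
  assumes g: "g \<in> rk_space"
  shows "dual_pair (dirac_cm k s) g = g s"
proof -
  have rep: "cm_rep (borel_k k) (dirac_cm k s) (point_mass s) (\<lambda>_. 1)" using cm_rep_dirac[of 1 s] by simp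
  show ?thesis
    using dual_pair_eq[OF M1_dirac rep g]
      integral_point_mass[OF rk_space_measurable[OF g sets_point_mass space_point_mass]] by simp
qed

lemma dual_pair_add_dirac_comb:
  assumes "M1 k \<xi>" "c \<in> finsupp" "g \<in> rk_space"
  shows "dual_pair (\<lambda>A. \<xi> A + dirac_comb c A) g = dual_pair \<xi> g + pairing g c"
  using M1_add_dirac_comb(2)[OF assms(1,2) antilinear_M1_dual_pair[OF assms(3)]]
  by (simp add: dual_pair_dirac[OF assms(3)])

lemma rk_embed_add_dirac_comb:
  assumes "M1 k \<xi>" "c \<in> finsupp"
  shows "rk_embed (\<lambda>A. \<xi> A + dirac_comb c A) = (\<lambda>s. rk_embed \<xi> s + comb c s)"
  by (simp add: rk_embed_def dual_pair_add_dirac_comb[OF assms kernel_in_rk_space] comb_pairing)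

lemma antilinear_M1_zero: "antilinear_M1 f \<Longrightarrow> f (\<lambda>A. 0) = 0"
  using antilinear_M1D[OF _ M1_zero M1_zero, of f 0 0] M1_zero by simp

text \<open>The potential of a finite combination is \<open>comb c\<close>, so its measure-theoretic
  energy agrees with the algebraic one. This makes the passage from coefficients to measures
  isometric.\<close>

lemma M1_dirac_comb:
  assumes c: "c \<in> finsupp"
  shows "M1 k (dirac_comb c)"
    and "antilinear_M1 f \<Longrightarrow> f (dirac_comb c) = pairing (\<lambda>s. f (dirac_cm k s)) c"
    and "Re (kform k (dirac_comb c) (dirac_comb c)) = sqn c"
proof -
  show M: "M1 k (dirac_comb c)" using M1_add_dirac_comb(1)[OF M1_zero c] by simp
  show "antilinear_M1 f \<Longrightarrow> f (dirac_comb c) = pairing (\<lambda>s. f (dirac_cm k s)) c"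
    using M1_add_dirac_comb(2)[OF M1_zero c, of f] antilinear_M1_zero[of f] by simp
  have "rk_embed (\<lambda>A. 0) = (\<lambda>s. 0)"
    by (simp add: rk_embed_def antilinear_M1_zero[OF antilinear_M1_dual_pair[OF kernel_in_rk_space]])
  then have "rk_embed (dirac_comb c) = comb c"
    using rk_embed_add_dirac_comb[OF M1_zero c] by simp
  then show "Re (kform k (dirac_comb c) (dirac_comb c)) = sqn c"
    by (simp add: kform_rk_embed[OF M] rk_norm_comb[OF c] sqn_nonneg[OF c])
qed

section \<open>Continuous antilinear functionals and their values on Dirac measures\<close>

lemma dual_M1_iff: "dual_M1 k f \<longleftrightarrow>
    antilinear_M1 f \<and> (\<exists>C. \<forall>\<xi>. M1 k \<xi> \<longrightarrow> cmod (f \<xi>) \<le> C * sqrt (Re (kform k \<xi> \<xi>)))"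
  by (simp add: dual_M1_def antilinear_M1_def)

lemma dual_M1_dual_pair: "g \<in> rk_space \<Longrightarrow> dual_M1 k (\<lambda>\<xi>. dual_pair \<xi> g)"
  using antilinear_M1_dual_pair dual_pair_bound by (auto simp: dual_M1_iff)

lemma kform_nonneg: "M1 k \<xi> \<Longrightarrow> 0 \<le> Re (kform k \<xi> \<xi>)"
  by (simp add: kform_rk_embed)

lemma dual_M1_bound:
  assumes "dual_M1 k f"
  obtains C where "0 \<le> C" "\<And>\<xi>. M1 k \<xi> \<Longrightarrow> cmod (f \<xi>) \<le> C * sqrt (Re (kform k \<xi> \<xi>))"
proof -
  obtain C where C: "\<And>\<xi>. M1 k \<xi> \<Longrightarrow> cmod (f \<xi>) \<le> C * sqrt (Re (kform k \<xi> \<xi>))"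
    using assms by (auto simp: dual_M1_iff)
  have "cmod (f \<xi>) \<le> \<bar>C\<bar> * sqrt (Re (kform k \<xi> \<xi>))" if "M1 k \<xi>" for \<xi>
    using C[OF that] kform_nonneg[OF that] mult_right_mono[of C "\<bar>C\<bar>" "sqrt (Re (kform k \<xi> \<xi>))"] by force
  then show thesis using that[of "\<bar>C\<bar>"] by simp
qed

text \<open>Restricted to finite combinations, the continuity estimate of \<open>f\<close> is
  exactly the estimate that characterises \<open>rk_space\<close>.\<close>

lemma dual_M1_dirac_in_rk_space:
  assumes f: "dual_M1 k f"
  shows "(\<lambda>s. f (dirac_cm k s)) \<in> rk_space"
proof -
  obtain C where C: "0 \<le> C" "\<And>\<xi>. M1 k \<xi> \<Longrightarrow> cmod (f \<xi>) \<le> C * sqrt (Re (kform k \<xi> \<xi>))"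
    using dual_M1_bound[OF f] by blast
  show ?thesis
  proof (rule rk_space_memI[OF C(1)])
    fix d :: "'a \<Rightarrow> complex" assume d: "d \<in> finsupp"
    show "cmod (pairing (\<lambda>s. f (dirac_cm k s)) d) \<le> C * sqrt (sqn d)"
      using C(2)[OF M1_dirac_comb(1)[OF d]] M1_dirac_comb(2,3)[OF d] f by (simp add: dual_M1_iff)
  qed
qed

text \<open>The difference of both sides is unchanged when a finite combination of Dirac measures is added to
  \<open>\<xi>\<close>, and the norm of such a modification of \<open>\<xi>\<close> can be made arbitrarily small.\<close>

lemma dual_M1_eq_dual_pair:
  assumes f: "dual_M1 k f" and \<xi>: "M1 k \<xi>"
  shows "f \<xi> = dual_pair \<xi> (\<lambda>s. f (dirac_cm k s))"
proof -
  define g where "g = (\<lambda>s. f (dirac_cm k s))"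
  have g: "g \<in> rk_space" unfolding g_def by (rule dual_M1_dirac_in_rk_space[OF f])
  obtain C where C: "0 \<le> C" "\<And>\<xi>. M1 k \<xi> \<Longrightarrow> cmod (f \<xi>) \<le> C * sqrt (Re (kform k \<xi> \<xi>))"
    using dual_M1_bound[OF f] by blast
  have "cmod (f \<xi> - dual_pair \<xi> g) \<le> e" if e: "0 < e" for e
  proof -
    \<comment> \<open>The sum of the bounds for the two functionals, plus 1 to keep the divisor
      positive.\<close>
    define r where "r = C + rk_norm g + 1"
    have r: "0 < r" using C(1) rk_norm_nonneg[OF g] by (simp add: r_def)
    \<comment> \<open>What is approximated is the potential of \<open>\<xi>\<close>. Subtracting the
      corresponding Dirac combination from \<open>\<xi>\<close> leaves a measure whose energy is the
      squared error.\<close>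
    obtain c where c: "c \<in> finsupp" "rk_norm (\<lambda>w. rk_embed \<xi> w - comb c w) < e / r"
      using comb_dense[OF rk_embed_in_rk_space[OF \<xi>], of "e / r"] e r by auto
    define d where "d = (\<lambda>x. (-1) * c x)"
    have d: "d \<in> finsupp" unfolding d_def by (rule finsupp_scale[OF c(1)])
    let ?\<eta> = "\<lambda>A. \<xi> A + dirac_comb d A"
    have \<eta>: "M1 k ?\<eta>" by (rule M1_add_dirac_comb(1)[OF \<xi> d])
    have "rk_embed ?\<eta> = (\<lambda>w. rk_embed \<xi> w - comb c w)"
      using rk_embed_add_dirac_comb[OF \<xi> d] comb_scale[OF c(1), of "-1"] by (simp add: d_def)
    then have small: "sqrt (Re (kform k ?\<eta> ?\<eta>)) < e / r"
      using c(2) rk_norm_nonneg[OF rk_embed_in_rk_space[OF \<eta>]] by (simp add: kform_rk_embed[OF \<eta>])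
    have "f ?\<eta> = f \<xi> + pairing g d"
      using M1_add_dirac_comb(2)[OF \<xi> d] f by (simp add: dual_M1_iff g_def)
    then have "f \<xi> - dual_pair \<xi> g = f ?\<eta> - dual_pair ?\<eta> g"
      by (simp add: dual_pair_add_dirac_comb[OF \<xi> d g])
    also have "cmod \<dots> \<le> cmod (f ?\<eta>) + cmod (dual_pair ?\<eta> g)" by (rule norm_triangle_ineq4)
    also have "\<dots> \<le> C * sqrt (Re (kform k ?\<eta> ?\<eta>)) + rk_norm g * sqrt (Re (kform k ?\<eta> ?\<eta>))"
      by (intro add_mono C(2) dual_pair_bound \<eta> g)
    also have "\<dots> \<le> r * sqrt (Re (kform k ?\<eta> ?\<eta>))"
      using kform_nonneg[OF \<eta>] by (simp add: r_def algebra_simps)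
    also have "\<dots> \<le> r * (e / r)" using small r by (intro mult_left_mono) auto
    finally show ?thesis using r by simp
  qed
  then have "cmod (f \<xi> - dual_pair \<xi> g) \<le> 0" by (rule field_le_epsilon) simp
  then show ?thesis by (simp add: g_def)
qed

text \<open>One inequality is the bound for \<open>dual_pair\<close>. For the other, finite
  combinations scaled into the unit ball already detect the whole norm, since \<open>rk_norm\<close>
  is the least constant for them.\<close>

lemma dual_norm_eq_rk_norm:
  assumes f: "dual_M1 k f"
  shows "dual_norm k f = rk_norm (\<lambda>s. f (dirac_cm k s))"
proof -
  define g where "g = (\<lambda>s. f (dirac_cm k s))"
  have g: "g \<in> rk_space" unfolding g_def by (rule dual_M1_dirac_in_rk_space[OF f])
  let ?U = "{\<xi>. M1 k \<xi> \<and> Re (kform k \<xi> \<xi>) \<le> 1}"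
  have ub: "cmod (f \<xi>) \<le> rk_norm g" if "\<xi> \<in> ?U" for \<xi>
  proof -
    have "cmod (f \<xi>) \<le> rk_norm g * sqrt (Re (kform k \<xi> \<xi>))"
      using dual_M1_eq_dual_pair[OF f] dual_pair_bound[OF _ g] that by (simp add: g_def)
    also have "\<dots> \<le> rk_norm g * 1"
      using that by (intro mult_left_mono rk_norm_nonneg[OF g]) simp
    finally show ?thesis by simp
  qed
  have zero: "(\<lambda>A. 0) \<in> ?U"
    using M1_zero M1_dirac_comb(3)[OF finsupp_zero]
    by (simp add: dirac_comb_def[abs_def] sqn_def pairing_def)
  have bdd: "bdd_above ((\<lambda>\<xi>. cmod (f \<xi>)) ` ?U)" using ub by (auto simp: bdd_above_def)
  have upper: "cmod (f \<xi>) \<le> dual_norm k f" if "\<xi> \<in> ?U" for \<xi>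
    unfolding dual_norm_def by (rule cSUP_upper[OF that bdd])
  have "dual_norm k f \<le> rk_norm g"
    unfolding dual_norm_def using zero ub by (intro cSUP_least) auto
  moreover have "rk_norm g \<le> dual_norm k f"
  proof (rule rk_norm_le)
    show "0 \<le> dual_norm k f" using upper[OF zero] norm_ge_zero order_trans by blast
    fix d :: "'a \<Rightarrow> complex" assume d: "d \<in> finsupp"
    show "cmod (pairing g d) \<le> dual_norm k f * sqrt (sqn d)"
    \<comment> \<open>A combination of energy 0 cannot be normalised, but the pairing vanishes on it
      by boundedness.\<close>
    proof (cases "sqn d = 0")
      case True
      then show ?thesis using pairing_bound[OF g d] by simp
    next
      case False
      define r where "r = sqrt (sqn d)"
      have r: "r > 0" using False sqn_nonneg[OF d] by (simp add: r_def)
      define d' where "d' = (\<lambda>x. of_real (1 / r) * d x)"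
      have d': "d' \<in> finsupp" unfolding d'_def by (rule finsupp_scale[OF d])
      have "sqn d' = (1 / r)\<^sup>2 * sqn d"
        unfolding d'_def sqn_scale[OF d] using r by (simp add: norm_divide)
      also have "\<dots> = 1" using r sqn_nonneg[OF d] False by (simp add: r_def power_divide)
      finally have "dirac_comb d' \<in> ?U" using M1_dirac_comb(1,3)[OF d'] by simp
      from upper[OF this] have "cmod (pairing g d') \<le> dual_norm k f"
        using M1_dirac_comb(2)[OF d', of f] f by (simp add: dual_M1_iff g_def)
      moreover have "pairing g d' = of_real (1 / r) * pairing g d"
        unfolding d'_def pairing_scale_right[OF d] by simp
      ultimately show ?thesis using r by (simp add: norm_divide r_def[symmetric] field_simps)
    qed
  qed
  ultimately show ?thesis by (simp add: g_def)
qed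

section \<open>Transport of the Hilbert space structure to the dual\<close>

lemma dual_M1_lin:
  assumes "dual_M1 k f" "dual_M1 k f'"
  shows "dual_M1 k (\<lambda>\<xi>. a * f \<xi> + b * f' \<xi>)"
  unfolding dual_M1_iff
proof
  show "antilinear_M1 (\<lambda>\<xi>. a * f \<xi> + b * f' \<xi>)"
    using assms unfolding dual_M1_iff antilinear_M1_def by (simp add: algebra_simps)
  obtain C C' where C: "\<And>\<xi>. M1 k \<xi> \<Longrightarrow> cmod (f \<xi>) \<le> C * sqrt (Re (kform k \<xi> \<xi>))"
      "\<And>\<xi>. M1 k \<xi> \<Longrightarrow> cmod (f' \<xi>) \<le> C' * sqrt (Re (kform k \<xi> \<xi>))"
    using dual_M1_bound assms by metis
  have "cmod (a * f \<xi> + b * f' \<xi>) \<le> (cmod a * C + cmod b * C') * sqrt (Re (kform k \<xi> \<xi>))" if \<xi>: "M1 k \<xi>" for \<xi>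
  proof -
    have "cmod (a * f \<xi> + b * f' \<xi>) \<le> cmod a * cmod (f \<xi>) + cmod b * cmod (f' \<xi>)"
      by (metis norm_mult norm_triangle_ineq)
    also have "\<dots> \<le> cmod a * (C * sqrt (Re (kform k \<xi> \<xi>))) + cmod b * (C' * sqrt (Re (kform k \<xi> \<xi>)))"
      by (intro add_mono mult_left_mono C \<xi>) auto
    finally show ?thesis by (simp add: algebra_simps)
  qed
  then show "\<exists>C. \<forall>\<xi>. M1 k \<xi> \<longrightarrow> cmod (a * f \<xi> + b * f' \<xi>) \<le> C * sqrt (Re (kform k \<xi> \<xi>))" by blast
qed

lemma dirac_restrictions_eq_rk_space: "{(\<lambda>s. f (dirac_cm k s)) | f. dual_M1 k f} = rk_space"
proof safe
  fix g assume g: "g \<in> rk_space"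
  then show "\<exists>f. g = (\<lambda>s. f (dirac_cm k s)) \<and> dual_M1 k f"
    by (intro exI[of _ "\<lambda>\<xi>. dual_pair \<xi> g"]) (simp add: dual_M1_dual_pair dual_pair_dirac)
qed (rule dual_M1_dirac_in_rk_space)

text \<open>The inner product pulled back along restriction to Dirac measures, which is injective
  because a functional is determined by these values.\<close>

definition dual_inner :: "(('a set \<Rightarrow> complex) \<Rightarrow> complex) \<Rightarrow> (('a set \<Rightarrow> complex) \<Rightarrow> complex) \<Rightarrow> complex" where
  "dual_inner F G = rk_inner (\<lambda>s. F (dirac_cm k s)) (\<lambda>s. G (dirac_cm k s))"

lemma hilbert_dual_inner: "hilbert_fun_space {tilde k f | f. dual_M1 k f} dual_inner"
proof -
  let ?H = "{tilde k f | f. dual_M1 k f}"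
  have H: "(\<lambda>s. F (dirac_cm k s)) \<in> rk_space" if "F \<in> ?H" for F
    using that dual_M1_dirac_in_rk_space by (auto simp: tilde_def M1_dirac)
  have lin: "(\<lambda>w. a * F w + b * G w) \<in> ?H" if FG: "F \<in> ?H" "G \<in> ?H" for F G a b
  proof -
    obtain f f' where f: "F = tilde k f" "dual_M1 k f" "G = tilde k f'" "dual_M1 k f'" using FG by blast
    then have "(\<lambda>w. a * F w + b * G w) = tilde k (\<lambda>\<xi>. a * f \<xi> + b * f' \<xi>)"
      by (auto simp: tilde_def)
    then show ?thesis using dual_M1_lin[OF f(2,4)] by blast
  qed
  have zero: "F = (\<lambda>_. 0)" if F: "F \<in> ?H" and "dual_inner F F = 0" for F
  proof -
    obtain f where f: "F = tilde k f" "dual_M1 k f" using F by blast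
    have "(\<lambda>s. f (dirac_cm k s)) = (\<lambda>_. 0)"
      using rk_inner_self[OF H[OF F]] rk_space_eval_bound[OF H[OF F]] that(2)
      by (auto simp: dual_inner_def f(1) tilde_def M1_dirac)
    then have "f \<xi> = 0" if "M1 k \<xi>" for \<xi>
      using dual_M1_eq_dual_pair[OF f(2) that] dual_pair_bound[OF that zero_in_rk_space]
        rk_norm_comb[OF finsupp_zero] by (simp add: comb_def[abs_def] sqn_def pairing_def)
    \<comment> \<open>Outside the measures of finite energy \<open>tilde\<close> is 0 by definition,
      so \<open>F\<close> is the zero function on all set functions.\<close>
    then show ?thesis by (auto simp: f(1) tilde_def)
  qed
  have complete: "\<exists>F\<in>?H. (\<lambda>n. sqrt (Re (dual_inner (\<lambda>w. X n w - F w) (\<lambda>w. X n w - F w)))) \<longlonglongrightarrow> 0"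
    if X: "\<forall>n. X n \<in> ?H"
      and Cau: "\<forall>e>0. \<exists>N. \<forall>m\<ge>N. \<forall>n\<ge>N. sqrt (Re (dual_inner (\<lambda>w. X m w - X n w) (\<lambda>w. X m w - X n w))) < e" for X
  proof -
    let ?Y = "\<lambda>n s. X n (dirac_cm k s)"
    have Y: "?Y n \<in> rk_space" for n using X H by blast
    have nrm: "sqrt (Re (rk_inner g g)) = rk_norm g" if "g \<in> rk_space" for g
      using rk_norm_nonneg[OF that] by (simp add: rk_inner_self[OF that])
    have "\<exists>N. \<forall>m\<ge>N. \<forall>n\<ge>N. rk_norm (\<lambda>s. ?Y m s - ?Y n s) < e" if "0 < e" for e
      using Cau that unfolding dual_inner_def by (simp add: nrm[OF rk_space_diff[OF Y Y]])
    then obtain g where g: "g \<in> rk_space" "(\<lambda>n. rk_norm (\<lambda>s. ?Y n s - g s)) \<longlonglongrightarrow> 0"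
      using rk_space_complete[of ?Y, OF Y] by blast
    \<comment> \<open>The limit of the restrictions is lifted back to a functional by integrating
      it.\<close>
    let ?F = "tilde k (\<lambda>\<xi>. dual_pair \<xi> g)"
    have F: "?F \<in> ?H" using dual_M1_dual_pair[OF g(1)] by blast
    have "?F (dirac_cm k s) = g s" for s
      by (simp add: tilde_def M1_dirac dual_pair_dirac[OF g(1)])
    then have "(\<lambda>n. sqrt (Re (dual_inner (\<lambda>w. X n w - ?F w) (\<lambda>w. X n w - ?F w)))) \<longlonglongrightarrow> 0"
      using g(2) unfolding dual_inner_def by (simp add: nrm[OF rk_space_diff[OF Y g(1)]])
    with F show ?thesis by (intro bexI[of _ ?F])
  qed
  show ?thesis
    unfolding hilbert_fun_space_def
  proof (intro conjI)
    have "tilde k (\<lambda>\<xi>. dual_pair \<xi> (\<lambda>_. 0)) \<in> ?H" using dual_M1_dual_pair[OF zero_in_rk_space] by blast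
    from lin[OF this this, of 0 0] show "(\<lambda>_. 0) \<in> ?H" by simp
    show "\<forall>x\<in>?H. \<forall>y\<in>?H. \<forall>a b. (\<lambda>w. a * x w + b * y w) \<in> ?H" using lin by blast
    show "\<forall>x\<in>?H. \<forall>y\<in>?H. \<forall>z\<in>?H. \<forall>a b.
        dual_inner (\<lambda>w. a * x w + b * y w) z = a * dual_inner x z + b * dual_inner y z"
      unfolding dual_inner_def by (intro ballI allI rk_inner_lin H)
    show "\<forall>x\<in>?H. \<forall>y\<in>?H. dual_inner y x = cnj (dual_inner x y)"
      unfolding dual_inner_def by (intro ballI rk_inner_cnj H)
    have "0 \<le> Re (dual_inner x x)" if "x \<in> ?H" for x
      unfolding dual_inner_def rk_inner_self[OF H[OF that]] by simp
    then show "\<forall>x\<in>?H. 0 \<le> Re (dual_inner x x) \<and> (dual_inner x x = 0 \<longrightarrow> x = (\<lambda>_. 0))"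
      using zero by blast
    show "\<forall>X. (\<forall>n. X n \<in> ?H) \<longrightarrow>
        (\<forall>e>0. \<exists>N. \<forall>m\<ge>N. \<forall>n\<ge>N. sqrt (Re (dual_inner (\<lambda>w. X m w - X n w) (\<lambda>w. X m w - X n w))) < e) \<longrightarrow>
        (\<exists>F\<in>?H. (\<lambda>n. sqrt (Re (dual_inner (\<lambda>w. X n w - F w) (\<lambda>w. X n w - F w)))) \<longlonglongrightarrow> 0)"
      using complete by blast
  qed
qed

end

theorem theorem5p4:
  fixes k :: "'s \<Rightarrow> 's \<Rightarrow> complex"
  assumes "pd_kernel k"
    and "Metric_space UNIV (dk k)"
  shows "(\<exists>ip. hilbert_fun_space {tilde k f | f. dual_M1 k f} ip \<and>
            (\<forall>f. dual_M1 k f \<longrightarrow>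
               ip (tilde k f) (tilde k f) = complex_of_real ((dual_norm k f)\<^sup>2)))
       \<and> (\<exists>ip. rkhs k {(\<lambda>s. f (dirac_cm k s)) | f. dual_M1 k f} ip \<and>
            (\<forall>f. dual_M1 k f \<longrightarrow>
               ip (\<lambda>s. f (dirac_cm k s)) (\<lambda>s. f (dirac_cm k s)) = complex_of_real ((dual_norm k f)\<^sup>2)))"
proof -
  note pd = assms(1)[unfolded pd_kernel_def]
  have "psd_kernel k"
  proof
    show "k s t = cnj (k t s)" for s t
      by (rule pd[THEN conjunct1, rule_format])
    show "0 \<le> Re (\<Sum>i<n. \<Sum>j<n. cnj (c i) * k (x i) (x j) * c j)" for n :: nat and c x
      by (rule pd[THEN conjunct2, THEN conjunct1, rule_format])
  qed
  then interpret metric_kernel k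
    by (rule metric_kernel.intro[OF _ metric_kernel_axioms.intro[OF assms(2)]])
  have norm: "rk_inner (\<lambda>s. f (dirac_cm k s)) (\<lambda>s. f (dirac_cm k s)) = complex_of_real ((dual_norm k f)\<^sup>2)"
    if "dual_M1 k f" for f
    using rk_inner_self[OF dual_M1_dirac_in_rk_space[OF that]] dual_norm_eq_rk_norm[OF that] by simp
  \<comment> \<open>Dirac measures have finite energy, so \<open>tilde\<close> leaves the values
    there unchanged.\<close>
  then have "dual_inner (tilde k f) (tilde k f) = complex_of_real ((dual_norm k f)\<^sup>2)" if "dual_M1 k f" for f
    using that by (simp add: dual_inner_def tilde_def M1_dirac)
  then show ?thesis
    using hilbert_dual_inner rkhs_rk_space norm unfolding dirac_restrictions_eq_rk_space by blast
qed

end
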